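(* Let $b$ be a positive integer relatively prime to $h$ and let $\widetilde w_b$ be the unique element of $\widetilde W$ with $\widetilde w_b(\check\rho/h)=b\check\rho/h$. Then $\widetilde w_b$ maps the Sommers region $\mathcal S_\Phi(b)$ bijectively onto $b\mathcal A$.
   Context: $\Phi$ is an irreducible crystallographic root system of rank $n$ in a Euclidean space $V$ with Weyl group $W$, positive roots $\Phi^+$, simple roots $\Delta=\{\alpha_1,\dots,\alpha_n\}$, highest root $\tilde\alpha$ (normalized $\|\tilde\alpha\|^2=2$), Coxeter number $h=1+\mathrm{ht}(\tilde\alpha)$, where $\mathrm{ht}(\sum a_i\alpha_i)=\sum a_i$; $\Phi_l$ denotes the set of roots of height $l$. $\check\rho=\sum_i\check\omega_i$ with fundamental coweights $\langle\check\omega_i,\alpha_j\rangle=\delta_{ij}$. The affine Weyl group $\widetilde W=W\ltimes\check Q$ is generated by reflections in the hyperplanes $\{x:\langle x,\alpha\rangle=k\}$, $\alpha\in\Phi,k\in\mathbb Z$. $b\mathcal A=\{x\in V:\langle x,\alpha\rangle\ge0\ \forall\alpha\in\Delta,\ \langle x,\tilde\alpha\rangle\le b\}$. Writing $b=th+r$ with integers $t\ge0$, $0<r<h$, $\mathcal S_\Phi(b)=\{x\in V:\langle x,\alpha\rangle\ge -t\ \forall\alpha\in\Phi_r,\ \langle x,\alpha\rangle\le t+1\ \forall\alpha\in\Phi_{h-r}\}$. *)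

theory Defs
  imports "HOL-Analysis.Analysis"
begin

section \<open>Root systems\<close>

definition coroot :: "'a::euclidean_space \<Rightarrow> 'a" where
  "coroot \<alpha> = (2 / (\<alpha> \<bullet> \<alpha>)) *\<^sub>R \<alpha>"

text \<open>The reflection in the affine hyperplane of all \<open>x\<close> with \<open>x \<bullet> \<alpha> = k\<close>.\<close>

definition affine_reflection :: "'a::euclidean_space \<Rightarrow> int \<Rightarrow> 'a \<Rightarrow> 'a" where
  "affine_reflection \<alpha> k x = x - (x \<bullet> \<alpha> - of_int k) *\<^sub>R coroot \<alpha>"

abbreviation root_reflection :: "'a::euclidean_space \<Rightarrow> 'a \<Rightarrow> 'a" where
  "root_reflection \<alpha> \<equiv> affine_reflection \<alpha> 0"

text \<open>
  Reduced crystallographic root systems. The ambient Euclidean space is the whole type, so the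
  rank is \<open>DIM('a)\<close>.
\<close>

definition root_system :: "'a::euclidean_space set \<Rightarrow> bool" where
  "root_system \<Phi> \<longleftrightarrow>
     finite \<Phi> \<and> 0 \<notin> \<Phi> \<and> span \<Phi> = UNIV \<and>
     (\<forall>\<alpha>\<in>\<Phi>. \<forall>c. c *\<^sub>R \<alpha> \<in> \<Phi> \<longrightarrow> c = 1 \<or> c = - 1) \<and>
     (\<forall>\<alpha>\<in>\<Phi>. \<forall>\<beta>\<in>\<Phi>. root_reflection \<alpha> \<beta> \<in> \<Phi>) \<and>
     (\<forall>\<alpha>\<in>\<Phi>. \<forall>\<beta>\<in>\<Phi>. \<beta> \<bullet> coroot \<alpha> \<in> \<int>)"

definition irreducible_root_system :: "'a::euclidean_space set \<Rightarrow> bool" where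
  "irreducible_root_system \<Phi> \<longleftrightarrow>
     root_system \<Phi> \<and>
     \<not> (\<exists>\<Psi>. \<Psi> \<noteq> {} \<and> \<Psi> \<subset> \<Phi> \<and> (\<forall>\<alpha>\<in>\<Psi>. \<forall>\<beta>\<in>\<Phi> - \<Psi>. \<alpha> \<bullet> \<beta> = 0))"

definition simple_system :: "'a::euclidean_space set \<Rightarrow> 'a set \<Rightarrow> bool" where
  "simple_system \<Phi> \<Delta> \<longleftrightarrow>
     \<Delta> \<subseteq> \<Phi> \<and> independent \<Delta> \<and> span \<Delta> = UNIV \<and>
     (\<forall>\<beta>\<in>\<Phi>. (\<forall>\<alpha>\<in>\<Delta>. representation \<Delta> \<beta> \<alpha> \<in> \<int>) \<and>
       ((\<forall>\<alpha>\<in>\<Delta>. representation \<Delta> \<beta> \<alpha> \<ge> 0) \<or> (\<forall>\<alpha>\<in>\<Delta>. representation \<Delta> \<beta> \<alpha> \<le> 0)))"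

definition height :: "'a::euclidean_space set \<Rightarrow> 'a \<Rightarrow> real" where
  "height \<Delta> v = (\<Sum>\<alpha>\<in>\<Delta>. representation \<Delta> v \<alpha>)"

definition roots_of_height :: "'a::euclidean_space set \<Rightarrow> 'a set \<Rightarrow> nat \<Rightarrow> 'a set" where
  "roots_of_height \<Phi> \<Delta> l = {\<alpha> \<in> \<Phi>. height \<Delta> \<alpha> = real l}"

text \<open>
  The highest root is the greatest element of the root poset: \<open>\<theta> - \<beta>\<close> is a nonnegative
  combination of simple roots for every root \<open>\<beta>\<close>.
\<close>

definition is_highest_root :: "'a::euclidean_space set \<Rightarrow> 'a set \<Rightarrow> 'a \<Rightarrow> bool" where
  "is_highest_root \<Phi> \<Delta> \<theta> \<longleftrightarrow>
     \<theta> \<in> \<Phi> \<and> (\<forall>\<beta>\<in>\<Phi>. \<forall>\<alpha>\<in>\<Delta>. representation \<Delta> (\<theta> - \<beta>) \<alpha> \<ge> 0)"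

definition fundamental_coweight :: "'a::euclidean_space set \<Rightarrow> 'a \<Rightarrow> 'a" where
  "fundamental_coweight \<Delta> \<alpha> = (THE \<omega>. \<forall>\<beta>\<in>\<Delta>. \<omega> \<bullet> \<beta> = (if \<beta> = \<alpha> then 1 else 0))"

definition rho_check :: "'a::euclidean_space set \<Rightarrow> 'a" where
  "rho_check \<Delta> = (\<Sum>\<alpha>\<in>\<Delta>. fundamental_coweight \<Delta> \<alpha>)"

lemma fundamental_coweight_unique:
  fixes \<Delta> :: "'a::euclidean_space set"
  assumes "independent \<Delta>" "span \<Delta> = UNIV"
  shows "\<exists>!\<omega>. \<forall>\<beta>\<in>\<Delta>. \<omega> \<bullet> \<beta> = (if \<beta> = \<alpha> then 1 else 0)"
proof -
  let ?f = "\<lambda>\<beta>. if \<beta> = \<alpha> then 1 else (0::real)"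
  obtain g :: "'a \<Rightarrow> real" where g: "linear g" "\<forall>\<beta>\<in>\<Delta>. g \<beta> = ?f \<beta>"
    using linear_independent_extend[OF assms(1), of ?f] by (elim exE conjE)
  define \<omega> where "\<omega> = adjoint g 1"
  have w: "\<omega> \<bullet> x = g x" for x
    using adjoint_works[OF g(1), of x 1] by (simp add: \<omega>_def inner_commute)
  show ?thesis
  proof (rule ex1I[of _ \<omega>])
    show "\<forall>\<beta>\<in>\<Delta>. \<omega> \<bullet> \<beta> = ?f \<beta>" using g w by auto
    fix \<eta> assume "\<forall>\<beta>\<in>\<Delta>. \<eta> \<bullet> \<beta> = ?f \<beta>"
    then have "(\<eta> - \<omega>) \<bullet> \<beta> = 0" if "\<beta> \<in> \<Delta>" for \<beta>
      using that g w by (simp add: inner_diff_left)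
    then have "orthogonal (\<eta> - \<omega>) (\<eta> - \<omega>)"
      using orthogonal_to_span[of "\<eta> - \<omega>" \<Delta> "\<eta> - \<omega>"] assms(2)
      by (auto simp: orthogonal_def)
    then show "\<eta> = \<omega>" by (simp add: orthogonal_def)
  qed
qed

lemma inner_rho_check_simple:
  fixes \<Delta> :: "'a::euclidean_space set"
  assumes "independent \<Delta>" "span \<Delta> = UNIV" "\<beta> \<in> \<Delta>"
  shows "rho_check \<Delta> \<bullet> \<beta> = 1"
proof -
  have fin: "finite \<Delta>" using assms(1) by (rule independent_imp_finite)
  have "fundamental_coweight \<Delta> \<alpha> \<bullet> \<beta> = (if \<beta> = \<alpha> then 1 else 0)" for \<alpha>
    using theI'[OF fundamental_coweight_unique[OF assms(1,2)]] assms(3)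
    unfolding fundamental_coweight_def by blast
  then show ?thesis
    using fin assms(3) by (simp add: rho_check_def inner_sum_left)
qed


section \<open>The affine Weyl group\<close>

text \<open>
  Reflections are involutions, so closing the identity under composition with reflections already
  gives the generated group.
\<close>

inductive_set weyl_group :: "'a::euclidean_space set \<Rightarrow> ('a \<Rightarrow> 'a) set"
  for \<Phi> :: "'a set" where
  id: "id \<in> weyl_group \<Phi>"
| refl: "\<alpha> \<in> \<Phi> \<Longrightarrow> w \<in> weyl_group \<Phi> \<Longrightarrow> root_reflection \<alpha> \<circ> w \<in> weyl_group \<Phi>"

inductive_set affine_weyl_group :: "'a::euclidean_space set \<Rightarrow> ('a \<Rightarrow> 'a) set"
  for \<Phi> :: "'a set" where
  id: "id \<in> affine_weyl_group \<Phi>"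
| refl: "\<alpha> \<in> \<Phi> \<Longrightarrow> w \<in> affine_weyl_group \<Phi> \<Longrightarrow>
           affine_reflection \<alpha> k \<circ> w \<in> affine_weyl_group \<Phi>"

definition coroot_lattice :: "'a::euclidean_space set \<Rightarrow> 'a set" where
  "coroot_lattice \<Phi> = {\<Sum>\<alpha>\<in>\<Phi>. of_int (c \<alpha>) *\<^sub>R coroot \<alpha> |c :: 'a \<Rightarrow> int. True}"

lemma coroot_lattice_add:
  assumes "p \<in> coroot_lattice \<Phi>" "q \<in> coroot_lattice \<Phi>"
  shows "p + q \<in> coroot_lattice \<Phi>"
proof -
  obtain c d where "p = (\<Sum>\<alpha>\<in>\<Phi>. of_int (c \<alpha>) *\<^sub>R coroot \<alpha>)"
    "q = (\<Sum>\<alpha>\<in>\<Phi>. of_int (d \<alpha>) *\<^sub>R coroot \<alpha>)"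
    using assms unfolding coroot_lattice_def by auto
  then have "p + q = (\<Sum>\<alpha>\<in>\<Phi>. of_int (c \<alpha> + d \<alpha>) *\<^sub>R coroot \<alpha>)"
    by (simp add: sum.distrib scaleR_add_left)
  then show ?thesis unfolding coroot_lattice_def
    by (intro CollectI exI[of _ "\<lambda>\<alpha>. c \<alpha> + d \<alpha>"]) auto
qed

lemma coroot_lattice_zero: "0 \<in> coroot_lattice \<Phi>"
  unfolding coroot_lattice_def by (intro CollectI exI[of _ "\<lambda>_. 0"]) auto

lemma coroot_lattice_generator:
  assumes "finite \<Phi>" "\<alpha> \<in> \<Phi>"
  shows "of_int k *\<^sub>R coroot \<alpha> \<in> coroot_lattice \<Phi>"
proof -
  have "of_int k *\<^sub>R coroot \<alpha> =
      (\<Sum>\<beta>\<in>\<Phi>. if \<beta> = \<alpha> then of_int k *\<^sub>R coroot \<beta> else 0)"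
    using assms by simp
  also have "\<dots> = (\<Sum>\<beta>\<in>\<Phi>. of_int (if \<beta> = \<alpha> then k else 0) *\<^sub>R coroot \<beta>)"
    by (intro sum.cong) auto
  finally show ?thesis unfolding coroot_lattice_def
    by (intro CollectI exI[of _ "\<lambda>\<beta>. if \<beta> = \<alpha> then k else 0"]) auto
qed

lemma root_reflection_add: "root_reflection \<alpha> (x + y) = root_reflection \<alpha> x + root_reflection \<alpha> y"
  by (simp add: affine_reflection_def algebra_simps)

lemma affine_reflection_eq:
  "affine_reflection \<alpha> k x = root_reflection \<alpha> x + of_int k *\<^sub>R coroot \<alpha>"
  by (simp add: affine_reflection_def algebra_simps)

lemma coroot_lattice_reflection:
  assumes "root_system \<Phi>" "\<alpha> \<in> \<Phi>" "q \<in> coroot_lattice \<Phi>"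
  shows "root_reflection \<alpha> q \<in> coroot_lattice \<Phi>"
proof -
  obtain c where q: "q = (\<Sum>\<beta>\<in>\<Phi>. of_int (c \<beta>) *\<^sub>R coroot \<beta>)"
    using assms(3) unfolding coroot_lattice_def by auto
  have "q \<bullet> \<alpha> = (\<Sum>\<beta>\<in>\<Phi>. of_int (c \<beta>) * (\<alpha> \<bullet> coroot \<beta>))"
    unfolding q inner_commute[of _ \<alpha>] by (simp add: inner_sum_right)
  also have "\<dots> \<in> \<int>"
    using assms(1,2) by (intro Ints_sum Ints_mult) (auto simp: root_system_def)
  finally obtain m where m: "q \<bullet> \<alpha> = of_int m" by (auto elim: Ints_cases)
  have "root_reflection \<alpha> q = q + of_int (- m) *\<^sub>R coroot \<alpha>"
    by (simp add: affine_reflection_def m)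
  then show ?thesis
    using coroot_lattice_add[OF assms(3) coroot_lattice_generator, of \<alpha> "- m"] assms
    by (simp add: root_system_def)
qed

lemma affine_weyl_group_translate:
  assumes "root_system \<Phi>" "\<alpha> \<in> \<Phi>" "w \<in> affine_weyl_group \<Phi>"
  shows "(\<lambda>x. w x + of_int k *\<^sub>R coroot \<alpha>) \<in> affine_weyl_group \<Phi>"
proof -
  have "\<alpha> \<bullet> \<alpha> \<noteq> 0" using assms by (auto simp: root_system_def)
  then have "root_reflection \<alpha> (root_reflection \<alpha> y) = y" for y
    by (simp add: affine_reflection_def coroot_def algebra_simps)
  then have "(\<lambda>x. w x + of_int k *\<^sub>R coroot \<alpha>) =
      affine_reflection \<alpha> k \<circ> (affine_reflection \<alpha> 0 \<circ> w)"
    by (auto simp: affine_reflection_eq[of \<alpha> k])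
  then show ?thesis using assms by (simp only: affine_weyl_group.refl)
qed

text \<open>The affine Weyl group is the semidirect product of the Weyl group and the coroot lattice.\<close>

lemma affine_weyl_group_eq:
  assumes "root_system \<Phi>"
  shows "affine_weyl_group \<Phi> =
    {\<lambda>x. u x + q |u q. u \<in> weyl_group \<Phi> \<and> q \<in> coroot_lattice \<Phi>}" (is "_ = ?R")
proof (intro set_eqI iffI)
  fix w assume "w \<in> affine_weyl_group \<Phi>"
  then show "w \<in> ?R"
  proof induction
    case id
    have "id = (\<lambda>x. id x + (0::'a))" by auto
    then show ?case using weyl_group.id coroot_lattice_zero by blast
  next
    case (refl \<alpha> w k)
    then obtain u q where uq: "w = (\<lambda>x. u x + q)" "u \<in> weyl_group \<Phi>" "q \<in> coroot_lattice \<Phi>"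
      by blast
    let ?q = "root_reflection \<alpha> q + of_int k *\<^sub>R coroot \<alpha>"
    have "affine_reflection \<alpha> k \<circ> w = (\<lambda>x. (root_reflection \<alpha> \<circ> u) x + ?q)"
      by (auto simp: uq affine_reflection_eq[of \<alpha> k] root_reflection_add)
    moreover have "root_reflection \<alpha> \<circ> u \<in> weyl_group \<Phi>"
      using refl uq by (intro weyl_group.refl)
    moreover have "?q \<in> coroot_lattice \<Phi>"
      using assms refl uq
      by (intro coroot_lattice_add coroot_lattice_reflection coroot_lattice_generator)
        (auto simp: root_system_def)
    ultimately show ?case by blast
  qed
next
  fix w assume "w \<in> ?R"
  then obtain u c where w: "w = (\<lambda>x. u x + (\<Sum>\<alpha>\<in>\<Phi>. of_int (c \<alpha>) *\<^sub>R coroot \<alpha>))"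
    and u: "u \<in> weyl_group \<Phi>"
    unfolding coroot_lattice_def by auto
  have u': "u \<in> affine_weyl_group \<Phi>"
    using u
  proof induction
    case id
    show ?case by (rule affine_weyl_group.id)
  next
    case (refl \<alpha> w)
    then show ?case by (intro affine_weyl_group.refl)
  qed
  have "finite \<Phi>" using assms by (simp add: root_system_def)
  have "(\<lambda>x. u x + (\<Sum>\<alpha>\<in>S. of_int (c \<alpha>) *\<^sub>R coroot \<alpha>)) \<in> affine_weyl_group \<Phi>"
    if "S \<subseteq> \<Phi>" for S
    using finite_subset[OF that \<open>finite \<Phi>\<close>] that
  proof (induction S)
    case empty
    then show ?case using u' by simp
  next
    case (insert \<alpha> S)
    then have "(\<lambda>x. (u x + (\<Sum>\<alpha>\<in>S. of_int (c \<alpha>) *\<^sub>R coroot \<alpha>)) + of_int (c \<alpha>) *\<^sub>R coroot \<alpha>)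
        \<in> affine_weyl_group \<Phi>"
      using affine_weyl_group_translate[OF assms] by blast
    then show ?case using insert by (simp add: algebra_simps)
  qed
  then show "w \<in> affine_weyl_group \<Phi>" using w by blast
qed


section \<open>The dilated alcove and the Sommers region\<close>

definition dilated_alcove :: "'a::euclidean_space set \<Rightarrow> 'a \<Rightarrow> nat \<Rightarrow> 'a set" where
  "dilated_alcove \<Delta> \<theta> b = {x. (\<forall>\<alpha>\<in>\<Delta>. x \<bullet> \<alpha> \<ge> 0) \<and> x \<bullet> \<theta> \<le> real b}"

text \<open>
  For \<open>b\<close> not divisible by \<open>h\<close>, the numbers \<open>t = b div h\<close> and \<open>r = b mod h\<close> are the unique ones
  with \<open>b = t * h + r\<close> and \<open>0 < r < h\<close>.
\<close>

definition sommers_region :: "'a::euclidean_space set \<Rightarrow> 'a set \<Rightarrow> nat \<Rightarrow> nat \<Rightarrow> 'a set" where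
  "sommers_region \<Phi> \<Delta> h b =
     (let t = b div h; r = b mod h in
       {x. (\<forall>\<alpha>\<in>roots_of_height \<Phi> \<Delta> r. x \<bullet> \<alpha> \<ge> - real t) \<and>
           (\<forall>\<alpha>\<in>roots_of_height \<Phi> \<Delta> (h - r). x \<bullet> \<alpha> \<le> real t + 1)})"

end

theory Submission
  imports Defs
begin

text \<open>
  Put \<open>x = \<rho>/h\<close>. Among the affine functions \<open>y \<bullet> \<alpha> - k\<close> with \<open>\<alpha> \<in> \<Phi>\<close> and \<open>k\<close> an integer,
  those with value \<open>b/h\<close> at \<open>x\<close> are exactly the ones defining the Sommers region, and those with
  value \<open>b/h\<close> at \<open>b x\<close> are exactly the ones defining \<open>b\<close> times the alcove. An element of the affine
  Weyl group that takes \<open>x\<close> to \<open>b x\<close> matches the two families.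

  Such an element exists: the point \<open>z\<close> nearest to \<open>x\<close> in the orbit of \<open>b x\<close> lies in the closed
  alcove, and on no reflecting hyperplane since \<open>b\<close> is coprime to \<open>h\<close>. Hence the numbers
  \<open>h (z \<bullet> \<alpha>\<^sub>i)\<close> are positive integers whose sum weighted by the coefficients of the highest root is
  less than \<open>h\<close>; all of them are 1, so \<open>z = x\<close>. It is unique because the stabiliser of \<open>x\<close> is
  trivial: a word in the reflections in the walls of the alcove that fixes \<open>x\<close> crosses some
  hyperplane twice and can be shortened.
\<close>

section \<open>Affine reflections\<close>

lemma coroot_minus: "coroot (- \<alpha>) = - coroot \<alpha>"
  by (simp add: coroot_def)

lemma affine_reflection_minus: "affine_reflection (- \<alpha>) (- k) = affine_reflection \<alpha> k"
  by (rule ext) (simp add: affine_reflection_def coroot_minus algebra_simps)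

lemma inner_affine_reflection_self:
  assumes "\<alpha> \<noteq> 0"
  shows "affine_reflection \<alpha> k x \<bullet> \<alpha> - of_int k = - (x \<bullet> \<alpha> - of_int k)"
proof -
  have "coroot \<alpha> \<bullet> \<alpha> = 2" using assms by (simp add: coroot_def)
  then show ?thesis by (simp add: affine_reflection_def inner_diff_left)
qed

lemma affine_reflection_involution:
  assumes "\<alpha> \<noteq> 0"
  shows "affine_reflection \<alpha> k (affine_reflection \<alpha> k x) = x"
  unfolding affine_reflection_def[of \<alpha> k "affine_reflection \<alpha> k x"]
    inner_affine_reflection_self[OF assms]
  by (simp add: affine_reflection_def algebra_simps)

lemma affine_reflection_involution_comp:
  assumes "\<alpha> \<noteq> 0"
  shows "affine_reflection \<alpha> k \<circ> affine_reflection \<alpha> k = id"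
  using affine_reflection_involution[OF assms] by auto

lemma root_reflection_altdef: "root_reflection \<beta> \<alpha> = \<alpha> - (\<alpha> \<bullet> coroot \<beta>) *\<^sub>R \<beta>"
  by (simp add: affine_reflection_def coroot_def)

text \<open>A reflection is a linear isometry, so the factor
  \<open>2 / (\<alpha> \<bullet> \<alpha>)\<close> is the same for \<alpha> and for its
  image.\<close>

lemma coroot_root_reflection:
  assumes "\<beta> \<noteq> 0"
  shows "coroot (root_reflection \<beta> \<alpha>) = root_reflection \<beta> (coroot \<alpha>)"
proof -
  have "root_reflection \<beta> \<alpha> \<bullet> root_reflection \<beta> \<alpha> = \<alpha> \<bullet> \<alpha>"
    using assms
    by (simp add: affine_reflection_def coroot_def inner_diff_left inner_diff_right inner_commute
        field_simps)
  then show ?thesis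
    by (simp add: coroot_def[of "root_reflection \<beta> \<alpha>"] coroot_def[of \<alpha>])
       (simp add: affine_reflection_def algebra_simps)
qed

text \<open>If a and c are the values of the affine function at \<open>z\<close> and at
  \<open>x\<close>, reflecting \<open>z\<close> changes the squared distance by 4 a c / (\<alpha>
  \<bullet> \<alpha>), which is negative for opposite signs.\<close>

lemma dist_affine_reflection_less:
  assumes "\<alpha> \<noteq> 0" "z \<bullet> \<alpha> - of_int k < 0" "x \<bullet> \<alpha> - of_int k > 0"
  shows "dist (affine_reflection \<alpha> k z) x < dist z x"
proof -
  let ?a = "z \<bullet> \<alpha> - of_int k" and ?c = "x \<bullet> \<alpha> - of_int k"
  have "(z - x) \<bullet> \<alpha> = ?a - ?c" by (simp add: algebra_simps)
  then have 1: "(z - x) \<bullet> coroot \<alpha> = 2 / (\<alpha> \<bullet> \<alpha>) * (?a - ?c)" by (simp add: coroot_def)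
  have 2: "coroot \<alpha> \<bullet> coroot \<alpha> = 4 / (\<alpha> \<bullet> \<alpha>)" using assms(1) by (simp add: coroot_def)
  have "affine_reflection \<alpha> k z - x = (z - x) - ?a *\<^sub>R coroot \<alpha>"
    by (simp add: affine_reflection_def)
  then have "(norm (affine_reflection \<alpha> k z - x))\<^sup>2 =
      (z - x) \<bullet> (z - x) - 2 * ?a * ((z - x) \<bullet> coroot \<alpha>) + ?a\<^sup>2 * (coroot \<alpha> \<bullet> coroot \<alpha>)"
    unfolding power2_norm_eq_inner
    by (simp only: inner_diff_left[of "z - x"] inner_diff_right[of _ "z - x"] inner_scaleR_left
        inner_scaleR_right inner_commute[of "coroot \<alpha>" "z - x"] power2_eq_square) (simp only: algebra_simps mult_2)
  also have "\<dots> = (z - x) \<bullet> (z - x) + 4 / (\<alpha> \<bullet> \<alpha>) * (?a * ?c)"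
  proof -
    \<comment> \<open>At \<open>n = 0\<close> both sides vanish, since division by zero yields
      0.\<close>
    have "- 2 * a * (2 / n * (a - c)) + a\<^sup>2 * (4 / n) = 4 / n * (a * c)" for a c n :: real
      by (cases "n = 0") (simp_all add: field_simps power2_eq_square)
    from this[of ?a "\<alpha> \<bullet> \<alpha>" ?c] show ?thesis unfolding 1 2 by linarith
  qed
  also have "\<dots> < (norm (z - x))\<^sup>2"
    using assms by (simp add: power2_norm_eq_inner divide_less_0_iff mult_less_0_iff)
  finally show ?thesis
    by (simp add: dist_norm power2_less_imp_less)
qed

lemma eq_of_inner_span:
  fixes x y :: "'a::euclidean_space"
  assumes "span B = UNIV" "\<And>\<beta>. \<beta> \<in> B \<Longrightarrow> x \<bullet> \<beta> = y \<bullet> \<beta>"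
  shows "x = y"
proof -
  have "orthogonal (x - y) (x - y)"
    using orthogonal_to_span[of "x - y" B "x - y"] assms
    by (auto simp: orthogonal_def inner_diff_left)
  then show ?thesis by (simp add: orthogonal_def)
qed


section \<open>The affine Weyl group acting on affine roots\<close>

context
  fixes \<Phi> :: "'a::euclidean_space set"
  assumes roots: "root_system \<Phi>"
begin

lemma root_nonzero: "\<alpha> \<in> \<Phi> \<Longrightarrow> \<alpha> \<noteq> 0"
  using roots by (auto simp: root_system_def)

lemma reflection_root: "\<alpha> \<in> \<Phi> \<Longrightarrow> \<beta> \<in> \<Phi> \<Longrightarrow> root_reflection \<alpha> \<beta> \<in> \<Phi>"
  using roots by (simp add: root_system_def)

lemma minus_root: "\<alpha> \<in> \<Phi> \<Longrightarrow> - \<alpha> \<in> \<Phi>"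
  using reflection_root[of \<alpha> \<alpha>] root_nonzero[of \<alpha>]
  by (simp add: root_reflection_altdef coroot_def scaleR_2)

text \<open>Reflections permute the affine roots, encoded as pairs of a root and an integer. The new
  root is \<open>root_reflection \<gamma> \<alpha>\<close>; its offset stays an integer because
  \<open>\<alpha> \<bullet> coroot \<gamma>\<close> is one. The last identity is conjugation of
  reflections.\<close>

lemma affine_reflection_pullback:
  assumes "\<alpha> \<in> \<Phi>" "\<gamma> \<in> \<Phi>"
  obtains \<beta> l where "\<beta> \<in> \<Phi>"
    "\<And>y. affine_reflection \<gamma> m y \<bullet> \<alpha> - of_int k = y \<bullet> \<beta> - of_int l"
    "affine_reflection \<gamma> m \<circ> affine_reflection \<beta> l = affine_reflection \<alpha> k \<circ> affine_reflection \<gamma> m"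
proof -
  have "\<alpha> \<bullet> coroot \<gamma> \<in> \<int>" using roots assms by (simp add: root_system_def)
  then obtain c where c: "\<alpha> \<bullet> coroot \<gamma> = of_int c" by (auto elim: Ints_cases)
  define \<beta> where "\<beta> = root_reflection \<gamma> \<alpha>"
  have \<beta>: "\<beta> = \<alpha> - of_int c *\<^sub>R \<gamma>" unfolding \<beta>_def root_reflection_altdef c ..
  have pull: "affine_reflection \<gamma> m y \<bullet> \<alpha> - of_int k = y \<bullet> \<beta> - of_int (k - m * c)" for y
    by (simp add: affine_reflection_def \<beta> inner_diff_left inner_diff_right
        inner_commute[of "coroot \<gamma>"] c algebra_simps)
  have "affine_reflection \<gamma> m (affine_reflection \<beta> (k - m * c) y) =
      affine_reflection \<alpha> k (affine_reflection \<gamma> m y)" for y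
  proof -
    have lin: "root_reflection \<gamma> (u - r *\<^sub>R v) = root_reflection \<gamma> u - r *\<^sub>R root_reflection \<gamma> v"
      for u v r by (simp add: affine_reflection_def algebra_simps)
    have "root_reflection \<gamma> (coroot \<beta>) = coroot \<alpha>"
      unfolding \<beta>_def coroot_root_reflection[OF root_nonzero[OF assms(2)]]
      by (rule affine_reflection_involution[OF root_nonzero[OF assms(2)]])
    then have "affine_reflection \<gamma> m (y - r *\<^sub>R coroot \<beta>) = affine_reflection \<gamma> m y - r *\<^sub>R coroot \<alpha>"
      for r by (simp add: affine_reflection_eq[of \<gamma> m] lin)
    then show ?thesis
      by (simp add: affine_reflection_def[of \<alpha>] affine_reflection_def[of \<beta>] pull
          del: of_int_diff of_int_mult)
  qed
  then have "affine_reflection \<gamma> m \<circ> affine_reflection \<beta> (k - m * c) =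
      affine_reflection \<alpha> k \<circ> affine_reflection \<gamma> m" by auto
  then show thesis
    using that[of \<beta> "k - m * c"] pull reflection_root assms unfolding \<beta>_def by blast
qed

text \<open>The affine root is pulled back through the outermost reflection first and the result
  through the rest, so the root and its offset must vary in the induction.\<close>

lemma affine_weyl_pullback:
  assumes "w \<in> affine_weyl_group \<Phi>" "\<alpha> \<in> \<Phi>"
  obtains \<beta> l where "\<beta> \<in> \<Phi>"
    "\<And>y. w y \<bullet> \<alpha> - of_int k = y \<bullet> \<beta> - of_int l"
    "w \<circ> affine_reflection \<beta> l = affine_reflection \<alpha> k \<circ> w"
  using assms
proof (induction arbitrary: \<alpha> k thesis)
  case id
  then show ?case by (metis comp_id id_apply id_comp)
next
  case (refl \<gamma> w m)
  obtain \<beta> l where 1: "\<beta> \<in> \<Phi>"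
    "\<And>y. affine_reflection \<gamma> m y \<bullet> \<alpha> - of_int k = y \<bullet> \<beta> - of_int l"
    "affine_reflection \<gamma> m \<circ> affine_reflection \<beta> l = affine_reflection \<alpha> k \<circ> affine_reflection \<gamma> m"
    using affine_reflection_pullback[OF refl.prems(2) refl.hyps(1)] by blast
  obtain \<delta> j where 2: "\<delta> \<in> \<Phi>"
    "\<And>y. w y \<bullet> \<beta> - of_int l = y \<bullet> \<delta> - of_int j"
    "w \<circ> affine_reflection \<delta> j = affine_reflection \<beta> l \<circ> w"
    using refl.IH[OF _ 1(1)] by blast
  show ?case
  proof (rule refl.prems(1)[OF 2(1)])
    show "(affine_reflection \<gamma> m \<circ> w) y \<bullet> \<alpha> - of_int k = y \<bullet> \<delta> - of_int j" for y
      using 1(2) 2(2) by simp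
    have "affine_reflection \<gamma> m \<circ> w \<circ> affine_reflection \<delta> j =
        affine_reflection \<gamma> m \<circ> (affine_reflection \<beta> l \<circ> w)"
      by (simp only: comp_assoc 2(3))
    also have "\<dots> = affine_reflection \<alpha> k \<circ> affine_reflection \<gamma> m \<circ> w"
      by (simp only: comp_assoc[symmetric] 1(3))
    finally show "affine_reflection \<gamma> m \<circ> w \<circ> affine_reflection \<delta> j =
        affine_reflection \<alpha> k \<circ> (affine_reflection \<gamma> m \<circ> w)"
      by (simp only: comp_assoc)
  qed
qed

lemma affine_weyl_comp:
  assumes "v \<in> affine_weyl_group \<Phi>" "w \<in> affine_weyl_group \<Phi>"
  shows "v \<circ> w \<in> affine_weyl_group \<Phi>"
  using assms(1)
proof induction
  case id
  then show ?case using assms(2) by simp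
next
  case (refl \<alpha> v k)
  show ?case
    using affine_weyl_group.refl[OF refl.hyps(1) refl.IH] by (simp only: comp_assoc)
qed

lemma affine_reflection_in_affine_weyl: "\<alpha> \<in> \<Phi> \<Longrightarrow> affine_reflection \<alpha> k \<in> affine_weyl_group \<Phi>"
  using affine_weyl_group.refl[OF _ affine_weyl_group.id] by fastforce

text \<open>Each reflection is its own inverse. A reflection added on the left of \<open>w\<close>
  goes to the right of the inverse, which needs closure under composition.\<close>

lemma affine_weyl_inverse:
  assumes "w \<in> affine_weyl_group \<Phi>"
  obtains v where "v \<in> affine_weyl_group \<Phi>" "v \<circ> w = id" "w \<circ> v = id"
  using assms
proof (induction arbitrary: thesis)
  case id
  show ?case by (rule id[OF affine_weyl_group.id]) simp_all
next
  case (refl \<alpha> w k)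
  obtain v where v: "v \<in> affine_weyl_group \<Phi>" "v \<circ> w = id" "w \<circ> v = id"
    using refl.IH by blast
  let ?s = "affine_reflection \<alpha> k"
  have s: "?s (?s y) = y" for y
    by (rule affine_reflection_involution[OF root_nonzero[OF refl.hyps(1)]])
  have "v \<circ> ?s \<in> affine_weyl_group \<Phi>"
    by (rule affine_weyl_comp[OF v(1) affine_reflection_in_affine_weyl[OF refl.hyps(1)]])
  then show ?case
    by (rule refl.prems) (use v s in \<open>auto simp: fun_eq_iff\<close>)
qed

end


section \<open>Words in affine reflections\<close>

text \<open>Lists instead of group elements allow letters to be counted and deleted. The head of the
  list acts last.\<close>

definition refl_word :: "('a::euclidean_space \<times> int) list \<Rightarrow> 'a \<Rightarrow> 'a" where
  "refl_word ws = foldr (\<lambda>(\<alpha>, k) w. affine_reflection \<alpha> k \<circ> w) ws id"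

lemma refl_word_Nil [simp]: "refl_word [] = id"
  and refl_word_Cons [simp]: "refl_word ((\<alpha>, k) # ws) = affine_reflection \<alpha> k \<circ> refl_word ws"
  by (simp_all add: refl_word_def)

lemma refl_word_append [simp]: "refl_word (us @ vs) = refl_word us \<circ> refl_word vs"
  by (induction us) (auto simp: comp_assoc)


section \<open>Roots and heights\<close>

locale based_root_system =
  fixes \<Phi> \<Delta> :: "'a::euclidean_space set" and \<theta> :: 'a and h :: nat
  assumes root_system: "root_system \<Phi>"
    and simple_system: "simple_system \<Phi> \<Delta>"
    and highest_root: "is_highest_root \<Phi> \<Delta> \<theta>"
    and coxeter_number: "real h = 1 + height \<Delta> \<theta>"
begin

abbreviation ht :: "'a \<Rightarrow> real" where "ht \<equiv> height \<Delta>"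
abbreviation rep :: "'a \<Rightarrow> 'a \<Rightarrow> real" where "rep \<equiv> representation \<Delta>"
text \<open>This is the point at which all walls of the fundamental alcove take the same value 1/h,
  as \<open>wall_x0\<close> shows.\<close>

definition x0 :: 'a where "x0 = (1 / real h) *\<^sub>R rho_check \<Delta>"

lemma simple_roots:
  shows indep: "independent \<Delta>" and span: "span \<Delta> = UNIV" and simple_root: "\<alpha> \<in> \<Delta> \<Longrightarrow> \<alpha> \<in> \<Phi>"
    and finite_simple: "finite \<Delta>"
  using simple_system independent_imp_finite unfolding simple_system_def by blast+

lemma highest: "\<theta> \<in> \<Phi>" "\<beta> \<in> \<Phi> \<Longrightarrow> \<alpha> \<in> \<Delta> \<Longrightarrow> rep \<beta> \<alpha> \<le> rep \<theta> \<alpha>"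
  using highest_root span
  by (auto simp: is_highest_root_def representation_diff[OF indep])

lemma rep_sum: "(\<Sum>\<alpha>\<in>\<Delta>. rep v \<alpha> *\<^sub>R \<alpha>) = v"
  using sum_representation_eq[OF indep, of v] finite_simple span by simp

lemma rep_eqI: "(\<And>\<alpha>. \<alpha> \<in> \<Delta> \<Longrightarrow> rep u \<alpha> = rep v \<alpha>) \<Longrightarrow> u = v"
  using sum.cong[OF HOL.refl, of \<Delta> "\<lambda>\<alpha>. rep u \<alpha> *\<^sub>R \<alpha>" "\<lambda>\<alpha>. rep v \<alpha> *\<^sub>R \<alpha>"]
  by (simp only: rep_sum)

lemma ht_scale: "ht (c *\<^sub>R u) = c * ht u"
  using span by (simp add: height_def representation_scale[OF indep] sum_distrib_left)

lemma ht_minus: "ht (- u) = - ht u"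
  using ht_scale[of "- 1" u] by simp

lemma rep_simple: "\<alpha> \<in> \<Delta> \<Longrightarrow> rep \<alpha> = (\<lambda>\<beta>. if \<beta> = \<alpha> then 1 else 0)"
  by (rule representation_basis[OF indep])

lemma ht_simple: "\<alpha> \<in> \<Delta> \<Longrightarrow> ht \<alpha> = 1"
  using finite_simple by (simp add: height_def rep_simple)

text \<open>Both sides are linear in \<open>v\<close> and equal 1 on the simple roots.\<close>

lemma inner_rho: "rho_check \<Delta> \<bullet> v = ht v"
proof -
  have "rho_check \<Delta> \<bullet> v = rho_check \<Delta> \<bullet> (\<Sum>\<alpha>\<in>\<Delta>. rep v \<alpha> *\<^sub>R \<alpha>)" by (simp only: rep_sum)
  also have "\<dots> = ht v"
    unfolding inner_sum_right height_def
    by (intro sum.cong) (simp_all add: inner_rho_check_simple[OF indep span])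
  finally show ?thesis .
qed

lemma ht_int: assumes "\<alpha> \<in> \<Phi>" obtains m :: int where "ht \<alpha> = of_int m"
proof -
  have "ht \<alpha> \<in> \<int>"
    using simple_system assms unfolding height_def simple_system_def by (intro Ints_sum) auto
  then show thesis using that by (auto elim: Ints_cases)
qed

lemma rep_sign: "\<alpha> \<in> \<Phi> \<Longrightarrow> (\<forall>\<beta>\<in>\<Delta>. rep \<alpha> \<beta> \<ge> 0) \<or> (\<forall>\<beta>\<in>\<Delta>. rep \<alpha> \<beta> \<le> 0)"
  using simple_system by (auto simp: simple_system_def)

lemma positive_rep:
  assumes "\<alpha> \<in> \<Phi>" "ht \<alpha> > 0" "\<beta> \<in> \<Delta>"
  shows "rep \<alpha> \<beta> \<ge> 0"
  using rep_sign[OF assms(1)]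
proof
  assume "\<forall>\<beta>\<in>\<Delta>. rep \<alpha> \<beta> \<le> 0"
  then have "ht \<alpha> \<le> 0" unfolding height_def by (intro sum_nonpos) blast
  then show ?thesis using assms(2) by simp
qed (use assms(3) in blast)

lemma negative_rep:
  assumes "\<alpha> \<in> \<Phi>" "ht \<alpha> < 0" "\<beta> \<in> \<Delta>"
  shows "rep \<alpha> \<beta> \<le> 0"
  using rep_sign[OF assms(1)]
proof
  assume "\<forall>\<beta>\<in>\<Delta>. rep \<alpha> \<beta> \<ge> 0"
  then have "ht \<alpha> \<ge> 0" unfolding height_def by (intro sum_nonneg) blast
  then show ?thesis using assms(2) by simp
qed (use assms(3) in blast)

text \<open>The coefficients of a root have one sign, so if their sum vanishes they all do, and 0 is
  not a root.\<close>

lemma ht_nonzero: assumes "\<alpha> \<in> \<Phi>" shows "ht \<alpha> \<noteq> 0"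
proof
  assume 0: "ht \<alpha> = 0"
  have "rep \<alpha> \<beta> = 0" if "\<beta> \<in> \<Delta>" for \<beta>
    using rep_sign[OF assms]
  proof
    assume "\<forall>\<beta>\<in>\<Delta>. rep \<alpha> \<beta> \<ge> 0"
    then show ?thesis using 0 that sum_nonneg_eq_0_iff[OF finite_simple, of "rep \<alpha>"]
      by (simp add: height_def)
  next
    assume "\<forall>\<beta>\<in>\<Delta>. rep \<alpha> \<beta> \<le> 0"
    then show ?thesis using 0 that sum_nonneg_eq_0_iff[OF finite_simple, of "\<lambda>\<beta>. - rep \<alpha> \<beta>"]
      by (simp add: height_def sum_negf)
  qed
  then have "\<alpha> = 0" by (intro rep_eqI) (simp add: representation_zero)
  then show False using root_nonzero[OF root_system assms] by simp
qed

section \<open>Bounds on heights and the roots of extreme height\<close>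

lemma ht_le: assumes "\<alpha> \<in> \<Phi>" shows "ht \<alpha> \<le> real h - 1"
  using highest(2)[OF assms] coxeter_number by (simp add: height_def sum_mono)

lemma ht_ge: assumes "\<alpha> \<in> \<Phi>" shows "ht \<alpha> \<ge> 1 - real h"
  using ht_le[OF minus_root[OF root_system assms]] by (simp add: ht_minus)

lemma ht_highest: "ht \<theta> = real h - 1"
  using coxeter_number by simp

lemma rep_highest_ge_1: "\<alpha> \<in> \<Delta> \<Longrightarrow> rep \<theta> \<alpha> \<ge> 1"
  using highest(2)[OF simple_root, of \<alpha> \<alpha>] by (simp add: rep_simple)

lemma h_ge_2: "h \<ge> 2"
proof -
  obtain m where m: "ht \<theta> = of_int m" using ht_int[OF highest(1)] by blast
  have "ht \<theta> \<ge> 0" unfolding height_def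
    by (intro sum_nonneg) (use rep_highest_ge_1 in force)
  then have "m \<ge> 1" using ht_nonzero[OF highest(1)] m by simp
  then show ?thesis using coxeter_number m by linarith
qed

text \<open>The coefficients of \<open>\<theta> - \<alpha>\<close> are nonnegative and sum to
  0.\<close>

lemma ht_eq_top: assumes "\<alpha> \<in> \<Phi>" "ht \<alpha> = real h - 1" shows "\<alpha> = \<theta>"
proof (rule rep_eqI)
  fix \<beta> assume \<beta>: "\<beta> \<in> \<Delta>"
  have "(\<Sum>\<beta>\<in>\<Delta>. rep \<theta> \<beta> - rep \<alpha> \<beta>) = 0"
    using assms(2) ht_highest by (simp add: height_def sum_subtractf)
  then show "rep \<alpha> \<beta> = rep \<theta> \<beta>"
    using highest(2)[OF assms(1)] \<beta>
      sum_nonneg_eq_0_iff[OF finite_simple, of "\<lambda>\<beta>. rep \<theta> \<beta> - rep \<alpha> \<beta>"] by simp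
qed

text \<open>The coefficients are nonnegative integers with sum 1, so one of them is 1 and the others
  vanish.\<close>

lemma ht_eq_1: assumes "\<alpha> \<in> \<Phi>" "ht \<alpha> = 1" shows "\<alpha> \<in> \<Delta>"
proof -
  have nonneg: "\<forall>\<beta>\<in>\<Delta>. rep \<alpha> \<beta> \<ge> 0"
    using positive_rep[OF assms(1)] assms(2) by simp
  obtain \<gamma> where \<gamma>: "\<gamma> \<in> \<Delta>" "rep \<alpha> \<gamma> \<noteq> 0"
  proof -
    have "\<not> (\<forall>\<gamma>\<in>\<Delta>. rep \<alpha> \<gamma> = 0)"
    proof
      assume "\<forall>\<gamma>\<in>\<Delta>. rep \<alpha> \<gamma> = 0"
      then have "ht \<alpha> = 0" unfolding height_def by (rule sum.neutral)
      then show False using assms(2) by simp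
    qed
    then show ?thesis using that by blast
  qed
  have "rep \<alpha> \<gamma> \<in> \<int>" using simple_system assms(1) \<gamma>(1) by (auto simp: simple_system_def)
  then obtain m where "rep \<alpha> \<gamma> = of_int m" by (auto elim: Ints_cases)
  then have ge: "rep \<alpha> \<gamma> \<ge> 1" using \<gamma> nonneg by force
  have split: "ht \<alpha> = rep \<alpha> \<gamma> + (\<Sum>\<beta>\<in>\<Delta> - {\<gamma>}. rep \<alpha> \<beta>)"
    unfolding height_def using finite_simple \<gamma>(1) by (rule sum.remove)
  have rest: "(\<Sum>\<beta>\<in>\<Delta> - {\<gamma>}. rep \<alpha> \<beta>) \<ge> 0" using nonneg by (intro sum_nonneg) auto
  have z: "rep \<alpha> \<beta> = 0" if "\<beta> \<in> \<Delta> - {\<gamma>}" for \<beta>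
  proof -
    have "(\<Sum>\<beta>\<in>\<Delta> - {\<gamma>}. rep \<alpha> \<beta>) = 0" using split rest ge assms(2) by linarith
    then show ?thesis
      using nonneg that finite_simple sum_nonneg_eq_0_iff[of "\<Delta> - {\<gamma>}" "rep \<alpha>"] by auto
  qed
  then have "rep \<alpha> \<gamma> = 1" using split assms(2) by simp
  then have "\<alpha> = \<gamma>" using z \<gamma>(1) by (intro rep_eqI) (auto simp: rep_simple)
  then show ?thesis using \<gamma> by simp
qed

section \<open>Reflections in simple roots and in the highest root\<close>

text \<open>The reflection alters only the coefficient of \<gamma>. Every other coefficient is both
  nonnegative and nonpositive, so \<alpha> is a multiple of \<gamma>, and the root system is
  reduced.\<close>

lemma simple_reflection_changes_sign:
  assumes "\<alpha> \<in> \<Phi>" "\<gamma> \<in> \<Delta>" "ht \<alpha> > 0" "ht (root_reflection \<gamma> \<alpha>) < 0"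
  shows "\<alpha> = \<gamma>"
proof -
  let ?\<beta> = "root_reflection \<gamma> \<alpha>"
  have pos: "\<forall>\<beta>\<in>\<Delta>. rep \<alpha> \<beta> \<ge> 0"
    using positive_rep assms(1,3) by blast
  have neg: "\<forall>\<beta>\<in>\<Delta>. rep ?\<beta> \<beta> \<le> 0"
    using negative_rep reflection_root[OF root_system simple_root[OF assms(2)] assms(1)] assms(4)
    by blast
  have z: "rep \<alpha> \<beta> = 0" if "\<beta> \<in> \<Delta>" "\<beta> \<noteq> \<gamma>" for \<beta>
  proof -
    have "rep ?\<beta> \<beta> = rep \<alpha> \<beta>"
      using that assms(2) span unfolding root_reflection_altdef
      by (simp add: representation_diff[OF indep] representation_scale[OF indep] rep_simple)
    then show ?thesis using pos neg that(1) by (metis order_antisym)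
  qed
  have "\<alpha> = (\<Sum>\<beta>\<in>\<Delta>. rep \<alpha> \<beta> *\<^sub>R \<beta>)" by (rule rep_sum[symmetric])
  also have "\<dots> = (\<Sum>\<beta>\<in>{\<gamma>}. rep \<alpha> \<beta> *\<^sub>R \<beta>)"
    using z finite_simple assms(2) by (intro sum.mono_neutral_right) auto
  finally have eq: "\<alpha> = rep \<alpha> \<gamma> *\<^sub>R \<gamma>" by simp
  have "rep \<alpha> \<gamma> = 1 \<or> rep \<alpha> \<gamma> = -1"
  proof -
    have "\<forall>c. c *\<^sub>R \<gamma> \<in> \<Phi> \<longrightarrow> c = 1 \<or> c = - 1"
      using root_system simple_root[OF assms(2)] unfolding root_system_def by blast
    then show ?thesis using assms(1) eq by metis
  qed
  moreover have "rep \<alpha> \<gamma> \<ge> 0" using pos assms(2) by blast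
  ultimately show ?thesis using eq by auto
qed

text \<open>With c the pairing, c \<theta> - \<alpha> is a root and hence coefficientwise at most
  \<theta>. For c \<ge> 2 this gives \<theta> \<le> \<alpha>, and \<theta> is the greatest root. No
  comparison of root lengths is involved.\<close>

lemma eq_highest:
  assumes "\<alpha> \<in> \<Phi>" "\<alpha> \<bullet> coroot \<theta> \<ge> 2"
  shows "\<alpha> = \<theta>"
proof (rule rep_eqI)
  fix \<beta> assume \<beta>: "\<beta> \<in> \<Delta>"
  let ?c = "\<alpha> \<bullet> coroot \<theta>"
  have "- root_reflection \<theta> \<alpha> \<in> \<Phi>"
    using root_system assms(1) highest(1) by (intro minus_root reflection_root)
  then have "rep (?c *\<^sub>R \<theta> - \<alpha>) \<beta> \<le> rep \<theta> \<beta>"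
    using highest(2) \<beta> by (simp add: root_reflection_altdef)
  then have "?c * rep \<theta> \<beta> \<le> rep \<theta> \<beta> + rep \<alpha> \<beta>"
    using span by (simp add: representation_diff[OF indep] representation_scale[OF indep])
  moreover have "2 * rep \<theta> \<beta> \<le> ?c * rep \<theta> \<beta>"
    using assms(2) rep_highest_ge_1[OF \<beta>] by (intro mult_right_mono) auto
  ultimately show "rep \<alpha> \<beta> = rep \<theta> \<beta>" using highest(2)[OF assms(1) \<beta>] by linarith
qed


section \<open>The stabiliser of the base point\<close>

lemma h_pos: "real h > 0"
  using h_ge_2 by simp

lemma inner_x0: "x0 \<bullet> v = ht v / real h"
  by (simp add: x0_def inner_rho)

text \<open>Heights of roots are nonzero integers strictly between -h and h.\<close>

lemma h_not_dvd_ht: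
  assumes "\<alpha> \<in> \<Phi>" "ht \<alpha> = of_int m"
  shows "\<not> int h dvd m"
proof
  assume "int h dvd m"
  moreover have "m \<noteq> 0" "\<bar>m\<bar> < int h"
    using ht_nonzero[OF assms(1)] ht_le[OF assms(1)] ht_ge[OF assms(1)] assms(2) by linarith+
  ultimately show False using dvd_imp_le_int[of m "int h"] by simp
qed

text \<open>For a root of height m the pairing is b m / h. If it is an integer, h divides b m, hence
  m by coprimality, which no height allows.\<close>

lemma regular_multiple:
  assumes "\<alpha> \<in> \<Phi>" "coprime b h"
  shows "(real b *\<^sub>R x0) \<bullet> \<alpha> - of_int k \<noteq> 0"
proof
  assume 0: "(real b *\<^sub>R x0) \<bullet> \<alpha> - of_int k = 0"
  obtain m where m: "ht \<alpha> = of_int m" using ht_int[OF assms(1)] by blast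
  have "(real b *\<^sub>R x0) \<bullet> \<alpha> = real b * of_int m / real h"
    unfolding inner_scaleR_left[of "real b"] inner_x0 m by simp
  then have "real b * of_int m / real h = of_int k" using 0 by linarith
  then have "real b * of_int m = of_int k * real h"
    using h_pos by (simp add: divide_eq_eq)
  then have "int b * m = k * int h"
    by (metis of_int_eq_iff of_int_mult of_int_of_nat_eq)
  then have "int h dvd int b * m" by simp
  moreover have "coprime (int h) (int b)" using assms(2) by (simp add: coprime_commute)
  ultimately show False
    using h_not_dvd_ht[OF assms(1) m] coprime_dvd_mult_right_iff by blast
qed

lemma regular: "\<alpha> \<in> \<Phi> \<Longrightarrow> x0 \<bullet> \<alpha> - of_int k \<noteq> 0"
  using regular_multiple[of \<alpha> 1 k] by simp

text \<open>The walls of the fundamental alcove, as affine functions \<open>y \<mapsto> y \<bullet> \<sigma> - m\<close> that are nonnegative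
  on it; the pair \<open>(- \<theta>, - 1)\<close> stands for \<open>1 - y \<bullet> \<theta>\<close>.\<close>

definition walls :: "('a \<times> int) set" where
  "walls = insert (- \<theta>, - 1) (\<Delta> \<times> {0})"

lemma wall_root: "(\<sigma>, m) \<in> walls \<Longrightarrow> \<sigma> \<in> \<Phi>"
  using minus_root[OF root_system highest(1)] simple_root by (auto simp: walls_def)

lemma wall_x0: "(\<sigma>, m) \<in> walls \<Longrightarrow> x0 \<bullet> \<sigma> - of_int m = 1 / real h"
  using h_pos by (auto simp: walls_def inner_x0 ht_simple ht_minus ht_highest field_simps)

text \<open>This is the affine form of the fact that a simple reflection permutes the positive roots
  other than its own. Values at \<open>x0\<close> and at its image are multiplied by h, so that only
  integers are compared.\<close>

lemma wall_crossing:
  assumes "(\<sigma>, m) \<in> walls" "\<alpha> \<in> \<Phi>"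
    and "x0 \<bullet> \<alpha> - of_int k > 0" "affine_reflection \<sigma> m x0 \<bullet> \<alpha> - of_int k < 0"
  shows "(\<alpha>, k) = (\<sigma>, m)"
proof -
  obtain a where a: "ht \<alpha> = of_int a" using ht_int[OF assms(2)] by blast
  have bounds: "\<bar>a\<bar> < int h"
    using ht_le[OF assms(2)] ht_ge[OF assms(2)] a by linarith
  have above: "k * int h < a"
  proof -
    have "of_int k * real h < of_int a"
      using assms(3) h_pos unfolding inner_x0 a by (simp add: field_simps)
    then show ?thesis by (metis of_int_less_iff of_int_mult of_int_of_nat_eq)
  qed
  from assms(1) consider (simple) "\<sigma> \<in> \<Delta>" "m = 0" | (affine) "\<sigma> = - \<theta>" "m = - 1"
    by (auto simp: walls_def)
  then show ?thesis
  proof cases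
    case simple
    define \<beta> where "\<beta> = root_reflection \<sigma> \<alpha>"
    have \<beta>: "\<beta> \<in> \<Phi>"
      unfolding \<beta>_def using simple simple_root assms(2) by (intro reflection_root[OF root_system]) auto
    obtain c where c: "ht \<beta> = of_int c" using ht_int[OF \<beta>] by blast
    have c_bounds: "\<bar>c\<bar> < int h" using ht_le[OF \<beta>] ht_ge[OF \<beta>] c by linarith
    have "affine_reflection \<sigma> m x0 \<bullet> \<alpha> = x0 \<bullet> \<beta>"
      unfolding \<beta>_def simple(2) affine_reflection_def coroot_def
      by (simp add: inner_diff_left inner_diff_right inner_commute[of \<sigma> \<alpha>])
    then have "of_int c / real h < of_int k"
      using assms(4) inner_x0[of \<beta>] c by simp
    then have "of_int c < of_int k * real h" using h_pos by (simp add: divide_less_eq)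
    then have below: "c < k * int h" by (metis of_int_less_iff of_int_mult of_int_of_nat_eq)
    \<comment> \<open>The multiple k h lies strictly between the heights c and a, both of absolute
      value less than h.\<close>
    have k0: "k = 0"
    proof (rule ccontr)
      assume "k \<noteq> 0"
      then consider "k \<ge> 1" | "k \<le> - 1" by linarith
      then show False
      proof cases
        case 1
        then have "1 * int h \<le> k * int h" by (intro mult_right_mono) auto
        then show False using above bounds by linarith
      next
        case 2
        then have "k * int h \<le> - 1 * int h" by (intro mult_right_mono) auto
        then show False using below c_bounds by linarith
      qed
    qed
    have "\<alpha> = \<sigma>"
      using simple_reflection_changes_sign[OF assms(2) simple(1)] above below a c k0
      by (simp add: \<beta>_def)
    then show ?thesis using k0 simple by simp
  next
    case affine
    have "\<alpha> \<bullet> coroot \<theta> \<in> \<int>"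
      using root_system assms(2) highest(1) by (auto simp: root_system_def)
    then obtain c where c: "\<alpha> \<bullet> coroot \<theta> = of_int c" by (auto elim: Ints_cases)
    have "x0 \<bullet> \<sigma> - of_int m = 1 / real h" by (rule wall_x0[OF assms(1)])
    then have "affine_reflection \<sigma> m x0 = x0 + (1 / real h) *\<^sub>R coroot \<theta>"
      unfolding affine_reflection_def affine(1) by (simp add: coroot_minus)
    then have "affine_reflection \<sigma> m x0 \<bullet> \<alpha> = x0 \<bullet> \<alpha> + of_int c / real h"
      using c by (simp add: inner_add_left inner_commute[of "coroot \<theta>" \<alpha>])
    also have "\<dots> = of_int (a + c) / real h"
      unfolding inner_x0 a by (simp add: add_divide_distrib)
    finally have "of_int (a + c) / real h < of_int k" using assms(4) by linarith
    then have "of_int (a + c) < of_int k * real h" using h_pos by (simp add: divide_less_eq)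
    then have below: "a + c < k * int h" by (metis of_int_less_iff of_int_mult of_int_of_nat_eq)
    \<comment> \<open>An integer lies strictly between a + c and a, so c \<le> -2.\<close>
    have "- \<alpha> \<bullet> coroot \<theta> \<ge> 2" using above below c by simp
    then have "- \<alpha> = \<theta>" by (intro eq_highest minus_root[OF root_system] assms(2))
    then have \<alpha>: "\<alpha> = - \<theta>" by (metis minus_minus)
    have "\<theta> \<noteq> 0" using root_nonzero[OF root_system] highest(1) by blast
    then have "c = - 2" using c unfolding \<alpha> by (simp add: coroot_def)
    moreover have "a = 1 - int h" using a ht_highest unfolding \<alpha> ht_minus by linarith
    ultimately have 1: "k * int h < 1 - int h" "- 1 - int h < k * int h"
      using above below by auto
    have "(k + 1) * int h = 0 "
    proof -
      have "(k + 1) * int h < 1" "(k + 1) * int h > - 1" using 1 by (simp_all add: algebra_simps)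
      then show ?thesis by linarith
    qed
    then have "k = - 1" using h_pos by simp
    then show ?thesis using \<alpha> affine by simp
  qed
qed

text \<open>The simple roots, weighted by the coefficients of \<theta>, and the normal -\<theta> sum
  to zero, with all weights at least 1. Without a positive inner product all of them would vanish,
  although the simple roots span.\<close>

lemma exists_wall_acute:
  assumes "\<alpha> \<noteq> 0"
  obtains \<sigma> m where "(\<sigma>, m) \<in> walls" "\<alpha> \<bullet> \<sigma> > 0"
proof (rule ccontr)
  assume "\<not> thesis"
  then have *: "\<alpha> \<bullet> \<sigma> \<le> 0" if "(\<sigma>, m) \<in> walls" for \<sigma> m
    using that \<open>\<And>\<sigma> m. (\<sigma>, m) \<in> walls \<Longrightarrow> \<alpha> \<bullet> \<sigma> > 0 \<Longrightarrow> thesis\<close> not_le by blast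
  have simple: "\<alpha> \<bullet> \<sigma> \<le> 0" if "\<sigma> \<in> \<Delta>" for \<sigma> using *[of \<sigma> 0] that by (simp add: walls_def)
  have "\<alpha> \<bullet> \<theta> \<ge> 0" using *[of "- \<theta>" "- 1"] by (simp add: walls_def)
  moreover have "\<alpha> \<bullet> \<theta> = (\<Sum>\<sigma>\<in>\<Delta>. rep \<theta> \<sigma> * (\<alpha> \<bullet> \<sigma>))"
    by (subst rep_sum[of \<theta>, symmetric]) (simp add: inner_sum_right)
  ultimately have ge: "(\<Sum>\<sigma>\<in>\<Delta>. rep \<theta> \<sigma> * (\<alpha> \<bullet> \<sigma>)) \<ge> 0" by simp
  have nonneg: "- (rep \<theta> \<sigma> * (\<alpha> \<bullet> \<sigma>)) \<ge> 0" if "\<sigma> \<in> \<Delta>" for \<sigma>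
    using rep_highest_ge_1[OF that] simple[OF that] by (simp add: mult_le_0_iff)
  have "(\<Sum>\<sigma>\<in>\<Delta>. - (rep \<theta> \<sigma> * (\<alpha> \<bullet> \<sigma>))) = 0"
    using ge sum_nonneg[of \<Delta> "\<lambda>\<sigma>. - (rep \<theta> \<sigma> * (\<alpha> \<bullet> \<sigma>))"] nonneg by (simp add: sum_negf)
  then have "rep \<theta> \<sigma> * (\<alpha> \<bullet> \<sigma>) = 0" if "\<sigma> \<in> \<Delta>" for \<sigma>
    using sum_nonneg_eq_0_iff[OF finite_simple, of "\<lambda>\<sigma>. - (rep \<theta> \<sigma> * (\<alpha> \<bullet> \<sigma>))"] nonneg that by simp
  then have "\<alpha> \<bullet> \<sigma> = 0 \<bullet> \<sigma>" if "\<sigma> \<in> \<Delta>" for \<sigma>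
    using rep_highest_ge_1[OF that] that by fastforce
  then have "\<alpha> = 0" by (rule eq_of_inner_span[OF span])
  then show False using assms by simp
qed

text \<open>Clearing the denominator h yields the measure for the induction in
  \<open>affine_reflection_word\<close>.\<close>

lemma positive_affine_root_int:
  assumes "\<alpha> \<in> \<Phi>" "x0 \<bullet> \<alpha> - of_int k > 0"
  obtains n :: nat where "x0 \<bullet> \<alpha> - of_int k = real n / real h" "n > 0"
proof -
  obtain a where a: "ht \<alpha> = of_int a" using ht_int[OF assms(1)] by blast
  have eq: "x0 \<bullet> \<alpha> - of_int k = of_int (a - k * int h) / real h"
    unfolding inner_x0 a using h_pos by (simp add: field_simps)
  have "real_of_int (a - k * int h) > 0"
    using assms(2) h_pos unfolding eq by (simp only: zero_less_divide_iff) linarith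
  then have "a - k * int h > 0" by (simp only: of_int_0_less_iff)
  then show thesis using that[of "nat (a - k * int h)"] eq by simp
qed

section \<open>Generation by the reflections in the walls\<close>

text \<open>Induction on h times the value at \<open>x0\<close>: an affine root that is not a wall
  is reflected in a wall with acute normal. It stays positive at \<open>x0\<close> with a smaller
  value, and conjugating its word gives the word sought.\<close>

lemma affine_reflection_word:
  assumes "\<alpha> \<in> \<Phi>"
  obtains ws where "set ws \<subseteq> walls" "refl_word ws = affine_reflection \<alpha> k"
proof -
  have pos: "\<exists>ws. set ws \<subseteq> walls \<and> refl_word ws = affine_reflection \<alpha> k"
    if "\<alpha> \<in> \<Phi>" "x0 \<bullet> \<alpha> - of_int k = real n / real h" "n > 0" for \<alpha> k n
    using that
  proof (induction n arbitrary: \<alpha> k rule: less_induct)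
    case (less n)
    show ?case
    proof (cases "(\<alpha>, k) \<in> walls")
      case True
      then show ?thesis by (intro exI[of _ "[(\<alpha>, k)]"]) simp
    next
      case False
      obtain \<sigma> m where \<sigma>: "(\<sigma>, m) \<in> walls" "\<alpha> \<bullet> \<sigma> > 0"
        using exists_wall_acute root_nonzero[OF root_system less.prems(1)] by blast
      let ?s = "affine_reflection \<sigma> m"
      have ss: "?s \<circ> ?s = id"
        using root_nonzero[OF root_system wall_root[OF \<sigma>(1)]]
        by (rule affine_reflection_involution_comp)
      obtain \<beta> l where \<beta>: "\<beta> \<in> \<Phi>" "\<And>y. ?s y \<bullet> \<alpha> - of_int k = y \<bullet> \<beta> - of_int l"
        "?s \<circ> affine_reflection \<beta> l = affine_reflection \<alpha> k \<circ> ?s"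
        using affine_reflection_pullback[OF root_system less.prems(1) wall_root[OF \<sigma>(1)]] by blast
      have x_pos: "x0 \<bullet> \<alpha> - of_int k > 0" using less.prems h_pos by simp
      \<comment> \<open>By \<open>wall_crossing\<close>, a change of sign would make (\<alpha>, k) a
        wall.\<close>
      then have "\<not> x0 \<bullet> \<beta> - of_int l < 0"
        using wall_crossing[OF \<sigma>(1) less.prems(1), of k] \<beta>(2)[of x0] False \<sigma>(1) by auto
      then have \<beta>_pos: "x0 \<bullet> \<beta> - of_int l > 0" using regular[OF \<beta>(1), of l] by linarith
      then obtain p where p: "x0 \<bullet> \<beta> - of_int l = real p / real h" "p > 0"
        using positive_affine_root_int[OF \<beta>(1)] by blast
      have "coroot \<sigma> \<bullet> \<alpha> > 0"
        using \<sigma>(2) root_nonzero[OF root_system wall_root[OF \<sigma>(1)]]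
        by (simp add: coroot_def inner_commute)
      \<comment> \<open>The wall has a positive value at \<open>x0\<close>, so the reflection moves
        \<open>x0\<close> against \<open>coroot \<sigma>\<close>, which lowers the value of
        \<alpha>.\<close>
      then have "?s x0 \<bullet> \<alpha> < x0 \<bullet> \<alpha>"
        using wall_x0[OF \<sigma>(1)] h_pos by (simp add: affine_reflection_def inner_diff_left)
      then have "real p / real h < real n / real h" using less.prems(2) p(1) \<beta>(2)[of x0] by linarith
      then have "p < n" using h_pos by (simp add: divide_less_cancel)
      then obtain ws where ws: "set ws \<subseteq> walls" "refl_word ws = affine_reflection \<beta> l"
        using less.IH[OF _ \<beta>(1) p] by blast
      have "refl_word ((\<sigma>, m) # ws @ [(\<sigma>, m)]) = (?s \<circ> affine_reflection \<beta> l) \<circ> ?s"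
        by (simp add: ws(2) comp_assoc)
      also have "\<dots> = affine_reflection \<alpha> k \<circ> (?s \<circ> ?s)" by (simp only: \<beta>(3) comp_assoc)
      also have "\<dots> = affine_reflection \<alpha> k" by (simp only: ss comp_id)
      finally show ?thesis using ws(1) \<sigma>(1) by (intro exI[of _ "(\<sigma>, m) # ws @ [(\<sigma>, m)]"]) auto
    qed
  qed
  \<comment> \<open>The pairs (\<alpha>, k) and (-\<alpha>, -k) define the same reflection, and one
    of them is positive at \<open>x0\<close>.\<close>
  consider "x0 \<bullet> \<alpha> - of_int k > 0" | "x0 \<bullet> (- \<alpha>) - of_int (- k) > 0"
    using regular[OF assms, of k] by (simp only: inner_minus_right of_int_minus) linarith
  then show thesis
  proof cases
    case 1
    then show ?thesis using that positive_affine_root_int[OF assms 1] pos[OF assms] by metis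
  next
    case 2
    have "- \<alpha> \<in> \<Phi>" by (rule minus_root[OF root_system assms])
    then show ?thesis
      using that positive_affine_root_int[OF _ 2] pos[of "- \<alpha>" "- k"] affine_reflection_minus by metis
  qed
qed

lemma affine_weyl_word:
  assumes "w \<in> affine_weyl_group \<Phi>"
  obtains ws where "set ws \<subseteq> walls" "refl_word ws = w"
  using assms
proof (induction arbitrary: thesis)
  case id
  show ?case by (rule id[of "[]"]) simp_all
next
  case (refl \<alpha> w k)
  obtain ws where ws: "set ws \<subseteq> walls" "refl_word ws = w" using refl.IH by blast
  obtain us where us: "set us \<subseteq> walls" "refl_word us = affine_reflection \<alpha> k"
    using affine_reflection_word[OF refl.hyps(1)] by blast
  show ?case by (rule refl.prems[of "us @ ws"]) (use ws us in auto)
qed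

lemma refl_word_in_affine_weyl: "set ws \<subseteq> walls \<Longrightarrow> refl_word ws \<in> affine_weyl_group \<Phi>"
proof (induction ws)
  case Nil
  show ?case unfolding refl_word_Nil by (rule affine_weyl_group.id)
next
  case (Cons a ws)
  obtain \<sigma> m where "a = (\<sigma>, m)" by fastforce
  then show ?case
    using Cons.prems Cons.IH affine_weyl_group.refl[OF wall_root[of \<sigma> m]]
    by (simp only: refl_word_Cons list.set insert_subset)
qed

section \<open>Galleries and deletion of letters\<close>

text \<open>The images of \<open>x0\<close> under the prefixes of \<open>ws\<close> form a gallery
  from \<open>x0\<close>. Where one letter crosses the hyperplane, pulling back through the prefix
  and applying \<open>wall_crossing\<close> identifies the pulled-back affine root with the wall of
  that letter; the commutation relation is this identification. The induction is from the right
  because prefixes grow there.\<close>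

lemma gallery_crosses_wall:
  assumes "\<alpha> \<in> \<Phi>" "set ws \<subseteq> walls" "x0 \<bullet> \<alpha> - of_int k > 0" "refl_word ws x0 \<bullet> \<alpha> - of_int k < 0"
  obtains us \<sigma> m vs where "ws = us @ (\<sigma>, m) # vs"
    "affine_reflection \<alpha> k \<circ> refl_word us = refl_word us \<circ> affine_reflection \<sigma> m"
  using assms
proof (induction ws arbitrary: thesis rule: rev_induct)
  case Nil
  then show ?case by simp
next
  case (snoc a ws)
  obtain \<sigma> m where a: "a = (\<sigma>, m)" by fastforce
  let ?v = "refl_word ws"
  have v: "?v \<in> affine_weyl_group \<Phi>" using snoc.prems by (intro refl_word_in_affine_weyl) simp
  obtain \<beta> l where \<beta>: "\<beta> \<in> \<Phi>" "\<And>y. ?v y \<bullet> \<alpha> - of_int k = y \<bullet> \<beta> - of_int l"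
    "?v \<circ> affine_reflection \<beta> l = affine_reflection \<alpha> k \<circ> ?v"
    using affine_weyl_pullback[OF root_system v snoc.prems(2)] by blast
  show ?case
  proof (cases "?v x0 \<bullet> \<alpha> - of_int k < 0")
    case True
    then obtain us \<tau> j vs where "ws = us @ (\<tau>, j) # vs"
      "affine_reflection \<alpha> k \<circ> refl_word us = refl_word us \<circ> affine_reflection \<tau> j"
      using snoc.IH[OF _ snoc.prems(2) _ snoc.prems(4) True] snoc.prems(3)
      unfolding set_append le_sup_iff by blast
    then show ?thesis using snoc.prems(1)[of us \<tau> j "vs @ [a]"] by simp
  next
    case False
    \<comment> \<open>The value is not negative, and by \<open>regular\<close> it is not
      zero.\<close>
    then have "x0 \<bullet> \<beta> - of_int l > 0" using \<beta>(2)[of x0] regular[OF \<beta>(1), of l] by linarith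
    moreover have "affine_reflection \<sigma> m x0 \<bullet> \<beta> - of_int l < 0"
      using snoc.prems(5) \<beta>(2)[of "affine_reflection \<sigma> m x0"] by (simp add: a)
    moreover have "(\<sigma>, m) \<in> walls" using snoc.prems(3) a by simp
    ultimately have "(\<beta>, l) = (\<sigma>, m)" using wall_crossing \<beta>(1) by blast
    then have "affine_reflection \<alpha> k \<circ> ?v = ?v \<circ> affine_reflection \<sigma> m"
      using \<beta>(3) by (simp only: prod.inject)
    then show ?thesis by (rule snoc.prems(1)[of ws \<sigma> m "[]", rotated]) (simp add: a)
  qed
qed

text \<open>If the word fixes \<open>x0\<close>, the letters after the first carry \<open>x0\<close>
  across the wall of the first letter. By \<open>gallery_crosses_wall\<close> the first letter then
  cancels against a later one, which leaves a word shorter by two.\<close>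

lemma stabilizer_word_trivial:
  assumes "set ws \<subseteq> walls" "refl_word ws x0 = x0"
  shows "refl_word ws = id"
  using assms
proof (induction "length ws" arbitrary: ws rule: less_induct)
  case less
  show ?case
  proof (cases ws)
    case (Cons a rest)
    obtain \<sigma> m where a: "a = (\<sigma>, m)" by fastforce
    let ?s = "affine_reflection \<sigma> m"
    have wall: "(\<sigma>, m) \<in> walls" and rest: "set rest \<subseteq> walls"
      using less.prems Cons a by auto
    have \<sigma>: "\<sigma> \<in> \<Phi>" "\<sigma> \<noteq> 0" using wall_root[OF wall] root_nonzero[OF root_system] by auto
    have x_pos: "x0 \<bullet> \<sigma> - of_int m > 0" using wall_x0[OF wall] h_pos by simp
    have "?s (refl_word rest x0) = x0" using less.prems(2) Cons a by simp
    then have "refl_word rest x0 \<bullet> \<sigma> - of_int m < 0"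
      using inner_affine_reflection_self[OF \<sigma>(2), of m "refl_word rest x0"] x_pos by simp
    then obtain us \<tau> j vs where split: "rest = us @ (\<tau>, j) # vs"
      and comm: "?s \<circ> refl_word us = refl_word us \<circ> affine_reflection \<tau> j"
      using gallery_crosses_wall[OF \<sigma>(1) rest x_pos] by blast
    have \<tau>: "\<tau> \<noteq> 0" using split rest wall_root[of \<tau> j] root_nonzero[OF root_system] by auto
    have "refl_word ws = (?s \<circ> refl_word us) \<circ> affine_reflection \<tau> j \<circ> refl_word vs"
      by (simp add: Cons a split comp_assoc)
    \<comment> \<open>Moved past \<open>us\<close>, the first letter becomes a second copy of the
      reflection that follows.\<close>
    also have "\<dots> = refl_word us \<circ> (affine_reflection \<tau> j \<circ> affine_reflection \<tau> j) \<circ> refl_word vs"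
      by (simp only: comm comp_assoc)
    also have "\<dots> = refl_word (us @ vs)"
      by (simp only: affine_reflection_involution_comp[OF \<tau>] comp_id refl_word_append)
    finally have eq: "refl_word ws = refl_word (us @ vs)" .
    have "refl_word (us @ vs) x0 = x0" using less.prems(2) by (simp only: eq)
    then have "refl_word (us @ vs) = id"
      using rest by (intro less.hyps) (auto simp: Cons split)
    then show ?thesis using eq by simp
  qed simp
qed

lemma stabilizer_trivial:
  assumes "w \<in> affine_weyl_group \<Phi>" "w x0 = x0"
  shows "w = id"
  using affine_weyl_word[OF assms(1)] stabilizer_word_trivial assms(2) by metis


section \<open>The orbit of the base point\<close>

text \<open>A point is determined by its pairings with the simple roots; in the ball, h times each
  pairing is an integer bounded by Cauchy-Schwarz. This provides a nearest point in the
  orbit.\<close>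

lemma finite_lattice_ball:
  fixes c :: 'a
  shows "finite {z. (\<forall>\<alpha>\<in>\<Delta>. real h * (z \<bullet> \<alpha>) \<in> \<int>) \<and> dist z c \<le> R}" (is "finite ?L")
proof -
  \<comment> \<open>Restricting to \<Delta> places \<open>f z\<close> in the finite function space
    \<open>PiE\<close>.\<close>
  define f where "f z = (\<lambda>\<alpha>\<in>\<Delta>. real h * (z \<bullet> \<alpha>))" for z
  define B where "B \<alpha> = real h * ((norm c + R) * norm \<alpha>)" for \<alpha> :: 'a
  have "inj_on f ?L"
  proof (rule inj_onI)
    fix y z assume "f y = f z"
    then have "y \<bullet> \<alpha> = z \<bullet> \<alpha>" if "\<alpha> \<in> \<Delta>" for \<alpha>
      using that h_pos unfolding f_def by (metis mult_cancel_left order_less_irrefl restrict_apply')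
    then show "y = z" by (rule eq_of_inner_span[OF span])
  qed
  moreover have "finite (f ` ?L)"
  proof (rule finite_subset)
    show "finite (PiE \<Delta> (\<lambda>\<alpha>. {k \<in> \<int>. \<bar>k\<bar> \<le> B \<alpha>}))"
      by (rule finite_PiE[OF finite_simple finite_abs_int_segment])
    show "f ` ?L \<subseteq> PiE \<Delta> (\<lambda>\<alpha>. {k \<in> \<int>. \<bar>k\<bar> \<le> B \<alpha>})"
    proof (intro image_subsetI PiE_I)
      fix z \<alpha> assume z: "z \<in> ?L" and \<alpha>: "\<alpha> \<in> \<Delta>"
      have "norm z \<le> norm c + R"
        using z norm_triangle_sub[of z c] by (auto simp: dist_norm)
      then have "\<bar>z \<bullet> \<alpha>\<bar> \<le> (norm c + R) * norm \<alpha>"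
        by (intro order_trans[OF Cauchy_Schwarz_ineq2] mult_right_mono) auto
      then have "\<bar>real h * (z \<bullet> \<alpha>)\<bar> \<le> B \<alpha>"
        using h_pos by (simp add: B_def abs_mult)
      then show "f z \<alpha> \<in> {k \<in> \<int>. \<bar>k\<bar> \<le> B \<alpha>}" using z \<alpha> by (simp add: f_def)
    qed (simp add: f_def)
  qed
  ultimately show ?thesis using finite_imageD by blast
qed

text \<open>Pulling \<alpha> back through \<open>w\<close> turns the pairing into b m / h - l for
  integers m and l.\<close>

lemma affine_weyl_multiple_lattice:
  assumes "w \<in> affine_weyl_group \<Phi>" "\<alpha> \<in> \<Phi>"
  shows "real h * (w (real b *\<^sub>R x0) \<bullet> \<alpha>) \<in> \<int>"
proof -
  obtain \<beta> l where \<beta>: "\<beta> \<in> \<Phi>" "\<And>y. w y \<bullet> \<alpha> - of_int 0 = y \<bullet> \<beta> - of_int l"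
    using affine_weyl_pullback[OF root_system assms] by blast
  obtain m where m: "ht \<beta> = of_int m" using ht_int[OF \<beta>(1)] by blast
  have "(real b *\<^sub>R x0) \<bullet> \<beta> = real b * of_int m / real h"
    by (simp add: inner_x0 m)
  then have "w (real b *\<^sub>R x0) \<bullet> \<alpha> = real b * of_int m / real h - of_int l"
    using \<beta>(2)[of "real b *\<^sub>R x0"] by linarith
  then have "real h * (w (real b *\<^sub>R x0) \<bullet> \<alpha>) = of_int (int b * m - int h * l)"
    using h_pos by (simp add: right_diff_distrib)
  then show ?thesis by (metis Ints_of_int)
qed

text \<open>The terms \<open>rep \<theta> \<sigma> * (real h * (z \<bullet> \<sigma>) - 1)\<close>
  are nonnegative by the simple walls, while their sum is at most 0 by the wall of -\<theta>. All
  vanish, and the coefficients of \<theta> are nonzero.\<close>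

lemma alcove_lattice_point:
  assumes "\<And>\<sigma> m. (\<sigma>, m) \<in> walls \<Longrightarrow> real h * (z \<bullet> \<sigma> - of_int m) \<ge> 1"
  shows "z = x0"
proof -
  have simple: "real h * (z \<bullet> \<sigma>) - 1 \<ge> 0" if "\<sigma> \<in> \<Delta>" for \<sigma>
    using assms[of \<sigma> 0] that by (simp add: walls_def)
  have "real h * (z \<bullet> \<theta>) \<le> real h - 1"
    using assms[of "- \<theta>" "- 1"] by (simp add: walls_def algebra_simps)
  moreover have "z \<bullet> \<theta> = (\<Sum>\<sigma>\<in>\<Delta>. rep \<theta> \<sigma> * (z \<bullet> \<sigma>))"
    by (subst rep_sum[of \<theta>, symmetric]) (simp add: inner_sum_right)
  ultimately have "(\<Sum>\<sigma>\<in>\<Delta>. rep \<theta> \<sigma> * (real h * (z \<bullet> \<sigma>))) \<le> ht \<theta>"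
    unfolding ht_highest by (simp add: sum_distrib_left mult.left_commute)
  then have le: "(\<Sum>\<sigma>\<in>\<Delta>. rep \<theta> \<sigma> * (real h * (z \<bullet> \<sigma>) - 1)) \<le> 0"
    by (simp add: height_def right_diff_distrib sum_subtractf)
  have nonneg: "rep \<theta> \<sigma> * (real h * (z \<bullet> \<sigma>) - 1) \<ge> 0" if "\<sigma> \<in> \<Delta>" for \<sigma>
    using simple[OF that] rep_highest_ge_1[OF that] by (intro mult_nonneg_nonneg) auto
  have "rep \<theta> \<sigma> * (real h * (z \<bullet> \<sigma>) - 1) = 0" if "\<sigma> \<in> \<Delta>" for \<sigma>
    using le nonneg that sum_nonneg[of \<Delta> "\<lambda>\<sigma>. rep \<theta> \<sigma> * (real h * (z \<bullet> \<sigma>) - 1)"]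
      sum_nonneg_eq_0_iff[OF finite_simple, of "\<lambda>\<sigma>. rep \<theta> \<sigma> * (real h * (z \<bullet> \<sigma>) - 1)"]
    by (meson order_antisym)
  then have "real h * (z \<bullet> \<sigma>) = 1" if "\<sigma> \<in> \<Delta>" for \<sigma>
    using rep_highest_ge_1[OF that] that by force
  then have "z \<bullet> \<sigma> = x0 \<bullet> \<sigma>" if "\<sigma> \<in> \<Delta>" for \<sigma>
    using that h_pos by (simp add: inner_x0 ht_simple eq_divide_eq mult.commute)
  then show ?thesis by (rule eq_of_inner_span[OF span])
qed

lemma exists_affine_weyl_multiple:
  assumes "coprime b h"
  obtains w where "w \<in> affine_weyl_group \<Phi>" "w x0 = real b *\<^sub>R x0"
proof -
  let ?y = "real b *\<^sub>R x0"
  define orb where "orb = (\<lambda>w. w ?y) ` affine_weyl_group \<Phi>"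
  define L where "L = {z \<in> orb. dist z x0 \<le> dist ?y x0}"
  have "L \<subseteq> {z. (\<forall>\<alpha>\<in>\<Delta>. real h * (z \<bullet> \<alpha>) \<in> \<int>) \<and> dist z x0 \<le> dist ?y x0}"
    unfolding L_def orb_def using affine_weyl_multiple_lattice simple_root by blast
  then have finite: "finite L" using finite_lattice_ball finite_subset by blast
  have "?y \<in> orb"
    unfolding orb_def using affine_weyl_group.id by (rule rev_image_eqI) simp
  then have y: "?y \<in> L" by (simp add: L_def)
  then obtain z where "is_arg_min (\<lambda>z. dist z x0) (\<lambda>z. z \<in> L) z"
    using finite ex_is_arg_min_if_finite by blast
  then have z: "z \<in> L" and L_min: "\<And>y. y \<in> L \<Longrightarrow> dist z x0 \<le> dist y x0"
    by (auto simp: is_arg_min_linorder)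
  \<comment> \<open>Orbit points outside \<open>L\<close> are farther from \<open>x0\<close> than
    \<open>?y\<close>, so the minimum over \<open>L\<close> is one over the orbit.\<close>
  have min: "dist z x0 \<le> dist y x0" if "y \<in> orb" for y
    using L_min[of y] z that by (cases "y \<in> L") (auto simp: L_def)
  obtain w where w: "w \<in> affine_weyl_group \<Phi>" "z = w ?y" using z by (auto simp: L_def orb_def)
  have "z = x0"
  proof (rule alcove_lattice_point)
    fix \<sigma> m assume wall: "(\<sigma>, m) \<in> walls"
    have \<sigma>: "\<sigma> \<in> \<Phi>" by (rule wall_root[OF wall])
    obtain \<beta> l where \<beta>: "\<beta> \<in> \<Phi>" "\<And>y. w y \<bullet> \<sigma> - of_int m = y \<bullet> \<beta> - of_int l"
      using affine_weyl_pullback[OF root_system w(1) \<sigma>] by blast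
    have nonzero: "z \<bullet> \<sigma> - of_int m \<noteq> 0"
      using regular_multiple[OF \<beta>(1) assms, of l] \<beta>(2)[of ?y] w(2) by simp
    \<comment> \<open>If \<open>z\<close> were on the negative side of a wall, reflecting it there
      would give an orbit point nearer to \<open>x0\<close>.\<close>
    have "\<not> z \<bullet> \<sigma> - of_int m < 0"
    proof
      assume "z \<bullet> \<sigma> - of_int m < 0"
      then have "dist (affine_reflection \<sigma> m z) x0 < dist z x0"
        using root_nonzero[OF root_system \<sigma>] wall_x0[OF wall] h_pos
        by (intro dist_affine_reflection_less) simp_all
      moreover have "affine_reflection \<sigma> m z \<in> orb"
        unfolding orb_def w(2)
        by (rule rev_image_eqI[OF affine_weyl_group.refl[OF \<sigma> w(1), of m]]) simp
      ultimately show False using min by fastforce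
    qed
    then have pos: "real h * (z \<bullet> \<sigma> - of_int m) > 0" using nonzero h_pos by simp
    obtain k where k: "real h * (z \<bullet> \<sigma>) = of_int k"
      using affine_weyl_multiple_lattice[OF w(1) \<sigma>] w(2) by (auto elim: Ints_cases)
    have eq: "real h * (z \<bullet> \<sigma> - of_int m) = of_int (k - int h * m)"
      by (simp add: right_diff_distrib k)
    \<comment> \<open>A positive integer is at least 1, the bound required by
      \<open>alcove_lattice_point\<close>.\<close>
    have "k - int h * m > 0" using pos by (simp only: eq of_int_0_less_iff)
    then show "real h * (z \<bullet> \<sigma> - of_int m) \<ge> 1"
      unfolding eq of_int_1_le_iff by linarith
  qed
  \<comment> \<open>This element goes from the multiple to \<open>x0\<close>; its inverse is the one
    wanted.\<close>
  then have "w ?y = x0" using w by simp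
  moreover obtain v where "v \<in> affine_weyl_group \<Phi>" "v \<circ> w = id"
    using affine_weyl_inverse[OF root_system w(1)] by blast
  ultimately show thesis using that by (metis comp_apply id_apply)
qed

text \<open>Two such elements differ by an element of the stabiliser of \<open>x0\<close>, which is
  trivial.\<close>

lemma ex1_affine_weyl_multiple:
  assumes "coprime b h"
  shows "\<exists>!w. w \<in> affine_weyl_group \<Phi> \<and> w x0 = real b *\<^sub>R x0"
proof -
  obtain w where w: "w \<in> affine_weyl_group \<Phi>" "w x0 = real b *\<^sub>R x0"
    using exists_affine_weyl_multiple[OF assms] by blast
  obtain v where v: "v \<in> affine_weyl_group \<Phi>" "v \<circ> w = id" "w \<circ> v = id"
    using affine_weyl_inverse[OF root_system w(1)] by blast
  show ?thesis
  proof (rule ex1I[of _ w])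
    fix u assume u: "u \<in> affine_weyl_group \<Phi> \<and> u x0 = real b *\<^sub>R x0"
    have "(v \<circ> u) x0 = x0" using u w(2) v(2) by (metis comp_apply id_apply)
    then have "v \<circ> u = id"
      using u v(1) by (intro stabilizer_trivial affine_weyl_comp[OF root_system]) auto
    then have "w \<circ> (v \<circ> u) = w" by simp
    then show "u = w" by (simp only: comp_assoc[symmetric] v(3) id_comp)
  qed (use w in simp)
qed


section \<open>The walls of the two regions\<close>

text \<open>The affine roots with value \<open>c\<close> at \<open>x\<close>. Both regions are cut
  out by such a set with the same \<open>c\<close>, once at \<open>x0\<close> and once at its
  multiple by b.\<close>

definition levels :: "real \<Rightarrow> 'a \<Rightarrow> ('a \<times> int) set" where
  "levels c x = {(\<alpha>, k). \<alpha> \<in> \<Phi> \<and> x \<bullet> \<alpha> - of_int k = c}"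

text \<open>A root of height m has level b/h exactly when b (m - 1) = k h. Coprimality gives m = 1
  modulo h, and the bounds on heights leave only the simple roots and -\<theta>.\<close>

lemma dilated_alcove_eq:
  assumes "b > 0" "coprime b h"
  shows "dilated_alcove \<Delta> \<theta> b =
    {y. \<forall>(\<alpha>, k) \<in> levels (real b / real h) (real b *\<^sub>R x0). y \<bullet> \<alpha> - of_int k \<ge> 0}"
proof -
  have level_iff: "(\<alpha>, k) \<in> levels (real b / real h) (real b *\<^sub>R x0) \<longleftrightarrow>
      (\<alpha> \<in> \<Delta> \<and> k = 0) \<or> (\<alpha> = - \<theta> \<and> k = - int b)" (is "?L \<longleftrightarrow> ?R") for \<alpha> k
  proof
    assume ?L
    then have \<alpha>: "\<alpha> \<in> \<Phi>" and eq: "(real b *\<^sub>R x0) \<bullet> \<alpha> - of_int k = real b / real h"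
      by (auto simp: levels_def)
    obtain m where m: "ht \<alpha> = of_int m" using ht_int[OF \<alpha>] by blast
    have "real b * of_int m / real h - of_int k = real b / real h" using eq by (simp add: inner_x0 m)
    then have "real b * (of_int m - 1) = of_int k * real h" using h_pos by (simp add: field_simps)
    then have int_eq: "int b * (m - 1) = k * int h"
      by (metis of_int_1 of_int_diff of_int_eq_iff of_int_mult of_int_of_nat_eq)
    then have "int h dvd int b * (m - 1)" by simp
    moreover have "coprime (int h) (int b)" using assms(2) by (simp add: coprime_commute)
    ultimately have dvd: "int h dvd m - 1" using coprime_dvd_mult_right_iff by blast
    have bounds: "m \<le> int h - 1" "m \<ge> 1 - int h"
      using ht_le[OF \<alpha>] ht_ge[OF \<alpha>] m by linarith+
    obtain q where q: "m - 1 = int h * q" using dvd by blast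
    \<comment> \<open>From -h \<le> m - 1 \<le> h - 2 the quotient q is 0 or -1.\<close>
    have "int h * q < int h * 1" "int h * q > int h * (- 2)" using q bounds h_ge_2 by linarith+
    then have "q < 1" "q > - 2" using h_pos by (simp_all only: mult_less_cancel_left)
    then consider "q = 0" | "q = - 1" by linarith
    then show ?R
    proof cases
      case 1
      then have "m = 1" "k = 0" using q int_eq h_pos by auto
      then show ?thesis using ht_eq_1[OF \<alpha>] m by simp
    next
      case 2
      then have m': "m = 1 - int h" using q by simp
      then have "(k + int b) * int h = 0" using int_eq[unfolded m'] by (simp add: algebra_simps)
      then have "k = - int b" using h_pos by simp
      moreover have "- \<alpha> = \<theta>"
        using m' m by (intro ht_eq_top minus_root[OF root_system \<alpha>]) (simp add: ht_minus)
      then have "\<alpha> = - \<theta>" by (metis minus_minus)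
      ultimately show ?thesis by simp
    qed
  next
    assume ?R
    then show ?L
      using simple_root minus_root[OF root_system highest(1)] h_pos
      by (auto simp: levels_def inner_x0 ht_simple ht_minus ht_highest field_simps)
  qed
  have "y \<in> dilated_alcove \<Delta> \<theta> b \<longleftrightarrow>
      (\<forall>(\<alpha>, k) \<in> levels (real b / real h) (real b *\<^sub>R x0). y \<bullet> \<alpha> - of_int k \<ge> 0)" for y
    unfolding Ball_def split_paired_All level_iff case_prod_conv
    by (auto simp: dilated_alcove_def)
  then show ?thesis by blast
qed

text \<open>A root of height m has level b/h at \<open>x0\<close> exactly when m - k h = t h + r.
  Hence m is congruent to r modulo h, and the bounds on heights leave m = r and m = r - h.\<close>

lemma sommers_region_eq:
  assumes "coprime b h"
  shows "sommers_region \<Phi> \<Delta> h b =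
    {y. \<forall>(\<alpha>, k) \<in> levels (real b / real h) x0. y \<bullet> \<alpha> - of_int k \<ge> 0}"
proof -
  define t where "t = b div h"
  define r where "r = b mod h"
  have b: "b = t * h + r" by (simp add: t_def r_def)
  have r_less: "r < h" using h_ge_2 by (simp add: r_def)
  \<comment> \<open>Since h \<ge> 2, coprimality rules out that h divides b.\<close>
  have r_pos: "r > 0"
  proof (rule ccontr)
    assume "\<not> r > 0"
    then have "h dvd b" by (simp add: r_def mod_eq_0_iff_dvd)
    then have "h dvd 1" using coprime_common_divisor[OF assms] by simp
    then show False using h_ge_2 by simp
  qed
  \<comment> \<open>The roots of height r - h are negatives of those of height h - r, so their lower
    bounds -t - 1 become the upper bounds t + 1 of the region.\<close>
  have level_iff: "(\<alpha>, k) \<in> levels (real b / real h) x0 \<longleftrightarrow>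
      (\<alpha> \<in> roots_of_height \<Phi> \<Delta> r \<and> k = - int t) \<or>
      (- \<alpha> \<in> roots_of_height \<Phi> \<Delta> (h - r) \<and> k = - int t - 1)" (is "?L \<longleftrightarrow> ?R") for \<alpha> k
  proof
    assume ?L
    then have \<alpha>: "\<alpha> \<in> \<Phi>" and eq: "x0 \<bullet> \<alpha> - of_int k = real b / real h"
      by (auto simp: levels_def)
    obtain m where m: "ht \<alpha> = of_int m" using ht_int[OF \<alpha>] by blast
    have "of_int m / real h - of_int k = real b / real h" using eq by (simp add: inner_x0 m)
    then have "of_int m - of_int k * real h = real b" using h_pos by (simp add: field_simps)
    then have "m - k * int h = int b"
      by (metis of_int_diff of_int_eq_iff of_int_mult of_int_of_nat_eq)
    then have m_eq: "m = int h * (k + int t) + int r" by (simp add: b algebra_simps)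
    have bounds: "m \<le> int h - 1" "m \<ge> 1 - int h"
      using ht_le[OF \<alpha>] ht_ge[OF \<alpha>] m by linarith+
    have "int h * (k + int t) < int h * 1" "int h * (k + int t) > int h * (- 2)"
      using m_eq bounds r_less r_pos by linarith+
    then have "k + int t < 1" "k + int t > - 2"
      using h_pos by (simp_all only: mult_less_cancel_left)
    then consider "k + int t = 0" | "k + int t = - 1" by linarith
    then show ?R
    proof cases
      case 1
      then have "m = int r" using m_eq by simp
      then show ?thesis using \<alpha> m 1 by (simp add: roots_of_height_def)
    next
      case 2
      then have "m = int r - int h" using m_eq by simp
      then show ?thesis
        using minus_root[OF root_system \<alpha>] m 2 r_less
        by (simp add: roots_of_height_def ht_minus of_nat_diff)
    qed
  next
    assume ?R
    then show ?L
    proof (elim disjE conjE)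
      assume "\<alpha> \<in> roots_of_height \<Phi> \<Delta> r" "k = - int t"
      then show ?L
        using h_pos by (auto simp: roots_of_height_def levels_def inner_x0 b field_simps)
    next
      assume *: "- \<alpha> \<in> roots_of_height \<Phi> \<Delta> (h - r)" "k = - int t - 1"
      then have "\<alpha> \<in> \<Phi>"
        using minus_root[OF root_system, of "- \<alpha>"] by (simp add: roots_of_height_def)
      moreover have "ht \<alpha> = real r - real h"
        using * r_less by (simp add: roots_of_height_def ht_minus of_nat_diff)
      ultimately show ?L
        using h_pos by (simp add: levels_def inner_x0 b *(2) add_divide_distrib diff_divide_distrib)
    qed
  qed
  have "y \<in> sommers_region \<Phi> \<Delta> h b \<longleftrightarrow>
      (\<forall>(\<alpha>, k) \<in> levels (real b / real h) x0. y \<bullet> \<alpha> - of_int k \<ge> 0)" (is "?A \<longleftrightarrow> ?B") for y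
  proof -
    have "?A \<longleftrightarrow> (\<forall>\<alpha>\<in>roots_of_height \<Phi> \<Delta> r. y \<bullet> \<alpha> - of_int (- int t) \<ge> 0) \<and>
        (\<forall>\<alpha>\<in>roots_of_height \<Phi> \<Delta> (h - r). y \<bullet> (- \<alpha>) - of_int (- int t - 1) \<ge> 0)"
      unfolding sommers_region_def Let_def t_def[symmetric] r_def[symmetric] by fastforce
    also have "\<dots> \<longleftrightarrow> ?B"
      unfolding Ball_def split_paired_All level_iff case_prod_conv by (metis minus_minus)
    finally show ?thesis .
  qed
  then show ?thesis by blast
qed

section \<open>Transport of one region onto the other\<close>

text \<open>Affine roots with value b/h at the image of \<open>x0\<close> pull back to affine roots
  with value b/h at \<open>x0\<close>, so the inequalities of the Sommers region imply those of the
  dilated alcove. The inverse element gives the other inclusion.\<close>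

lemma sommers_bij:
  assumes "b > 0" "coprime b h" "w \<in> affine_weyl_group \<Phi>" "w x0 = real b *\<^sub>R x0"
  shows "bij_betw w (sommers_region \<Phi> \<Delta> h b) (dilated_alcove \<Delta> \<theta> b)"
proof -
  obtain v where v: "v \<in> affine_weyl_group \<Phi>" "v \<circ> w = id" "w \<circ> v = id"
    using affine_weyl_inverse[OF root_system assms(3)] by blast
  have vw: "v (w y) = y" and wv: "w (v y) = y" for y
    using v(2,3) by (metis comp_apply id_apply)+
  \<comment> \<open>A general \<open>u\<close> serves both for \<open>w\<close> and for its
    inverse.\<close>
  have transport: "\<forall>(\<alpha>, k) \<in> levels c (u x). u y \<bullet> \<alpha> - of_int k \<ge> 0"
    if u: "u \<in> affine_weyl_group \<Phi>" and y: "\<forall>(\<alpha>, k) \<in> levels c x. y \<bullet> \<alpha> - of_int k \<ge> 0"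
    for u c x y
  proof (clarsimp simp only: levels_def mem_Collect_eq case_prod_conv)
    fix \<alpha> k assume \<alpha>: "\<alpha> \<in> \<Phi>" and c: "c = u x \<bullet> \<alpha> - of_int k"
    obtain \<beta> l where \<beta>: "\<beta> \<in> \<Phi>" "\<And>y. u y \<bullet> \<alpha> - of_int k = y \<bullet> \<beta> - of_int l"
      using affine_weyl_pullback[OF root_system u \<alpha>] by blast
    then have "(\<beta>, l) \<in> levels c x" unfolding levels_def c by simp
    then show "u y \<bullet> \<alpha> - of_int k \<ge> 0" using y \<beta>(2) by fastforce
  qed
  show ?thesis
  proof (rule bij_betw_byWitness[of _ v])
    show "w ` sommers_region \<Phi> \<Delta> h b \<subseteq> dilated_alcove \<Delta> \<theta> b"
      unfolding sommers_region_eq[OF assms(2)] dilated_alcove_eq[OF assms(1,2)]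
      using transport[OF assms(3), of _ x0] unfolding assms(4) by blast
    \<comment> \<open>The multiple of \<open>x0\<close> is rewritten as \<open>w x0\<close>, which
      \<open>v\<close> takes back to \<open>x0\<close>.\<close>
    show "v ` dilated_alcove \<Delta> \<theta> b \<subseteq> sommers_region \<Phi> \<Delta> h b"
      unfolding sommers_region_eq[OF assms(2)] dilated_alcove_eq[OF assms(1,2)]
      using transport[OF v(1), of _ "real b *\<^sub>R x0"] unfolding assms(4)[symmetric] vw by blast
  qed (simp_all add: vw wv)
qed

end

theorem theorem4p2:
  fixes \<Phi> \<Delta> :: "'a::euclidean_space set" and \<theta> :: 'a and h b :: nat
  assumes "irreducible_root_system \<Phi>"
    and "simple_system \<Phi> \<Delta>"
    and "is_highest_root \<Phi> \<Delta> \<theta>"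
    and "(norm \<theta>)\<^sup>2 = 2"
    and "real h = 1 + height \<Delta> \<theta>"
    and "b > 0"
    and "coprime b h"
  shows "(\<exists>!w. w \<in> affine_weyl_group \<Phi> \<and>
             w ((1 / real h) *\<^sub>R rho_check \<Delta>) = (real b / real h) *\<^sub>R rho_check \<Delta>) \<and>
         bij_betw
           (THE w. w \<in> affine_weyl_group \<Phi> \<and>
             w ((1 / real h) *\<^sub>R rho_check \<Delta>) = (real b / real h) *\<^sub>R rho_check \<Delta>)
           (sommers_region \<Phi> \<Delta> h b) (dilated_alcove \<Delta> \<theta> b)"
proof -
  interpret based_root_system \<Phi> \<Delta> \<theta> h
    using assms by unfold_locales (auto simp: irreducible_root_system_def)
  have x0: "(1 / real h) *\<^sub>R rho_check \<Delta> = x0"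
    "(real b / real h) *\<^sub>R rho_check \<Delta> = real b *\<^sub>R x0"
    by (simp_all add: x0_def)
  note ex1 = ex1_affine_weyl_multiple[OF assms(7)]
  show ?thesis
    unfolding x0 using ex1 theI'[OF ex1] sommers_bij[OF assms(6,7)] by blast
qed

end
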